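(* There exist absolute constants $K>0$ and $C>0$ such that the following holds. Let $n\ge1$ and $p\in(0,1)$ be such that $pn$ is an integer and $p(1-p)n\ge3\log n$. Let $f$ be a real harmonic multilinear polynomial in $x_1,\dots,x_n$ of degree $d$ satisfying $d\le K\sqrt{p(1-p)n}$ and $\|f\|_{\nu_{pn}}=1$. Then $$\Bigl|\mathbb E_{\nu_{pn}}[(|f|-1)^2]-\mathbb E_{\mu_p}[(|f|-1)^2]\Bigr|\le C\left(\frac{d}{\sqrt{p(1-p)n}}\right)^{1/4}(p(1-p))^{-Cd}.$$
   Context: A polynomial in $x_1,\dots,x_n$ is multilinear if all its monomials are squarefree, and harmonic if $\sum_{i=1}^n \frac{\partial f}{\partial x_i}=0$. For an integer $0\le k\le n$, $\nu_k$ is the uniform probability measure on the slice $\{x\in\{0,1\}^n:\sum_i x_i=k\}$. For $p\in(0,1)$, $\mu_p$ is the product measure on $\{0,1\}^n$ with $\mu_p(x)=p^{\sum_i x_i}(1-p)^{\sum_i(1-x_i)}$. For a measure $\alpha$, $\|f\|_\alpha=\sqrt{\mathbb E_\alpha[f^2]}$. *)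

theory Defs
  imports "HOL-Probability.Probability" "HOL-Library.Poly_Mapping"
begin

text \<open>
  Real polynomials in the variables \<open>x\<^sub>i\<close>, \<open>i :: nat\<close>: a monomial is its finitely supported
  exponent vector, a polynomial its finitely supported coefficient function.
\<close>

type_synonym monomial = "nat \<Rightarrow>\<^sub>0 nat"
type_synonym real_mpoly = "monomial \<Rightarrow>\<^sub>0 real"

definition poly_in_vars :: "nat \<Rightarrow> real_mpoly \<Rightarrow> bool" where
  "poly_in_vars n f \<longleftrightarrow> (\<forall>m\<in>Poly_Mapping.keys f. Poly_Mapping.keys m \<subseteq> {1..n})"

definition poly_eval :: "real_mpoly \<Rightarrow> (nat \<Rightarrow> real) \<Rightarrow> real" where
  "poly_eval f x =
     (\<Sum>m\<in>Poly_Mapping.keys f.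
        Poly_Mapping.lookup f m * (\<Prod>i\<in>Poly_Mapping.keys m. x i ^ Poly_Mapping.lookup m i))"

text \<open>The total degree; the zero polynomial gets degree \<open>0\<close>.\<close>

definition total_degree :: "real_mpoly \<Rightarrow> nat" where
  "total_degree f =
     Max (insert 0 ((\<lambda>m. \<Sum>i\<in>Poly_Mapping.keys m. Poly_Mapping.lookup m i) ` Poly_Mapping.keys f))"

text \<open>
  Truncated subtraction of exponents is harmless below: if \<open>x\<^sub>i\<close> does not occur in \<open>m\<close>, the
  new coefficient is \<open>0\<close>.
\<close>

definition partial_deriv :: "nat \<Rightarrow> real_mpoly \<Rightarrow> real_mpoly" where
  "partial_deriv i f =
     (\<Sum>m\<in>Poly_Mapping.keys f.
        Poly_Mapping.single (m - Poly_Mapping.single i 1)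
          (real (Poly_Mapping.lookup m i) * Poly_Mapping.lookup f m))"

definition multilinear_poly :: "real_mpoly \<Rightarrow> bool" where
  "multilinear_poly f \<longleftrightarrow>
     (\<forall>m\<in>Poly_Mapping.keys f. \<forall>i. Poly_Mapping.lookup m i \<le> 1)"

definition harmonic_poly :: "nat \<Rightarrow> real_mpoly \<Rightarrow> bool" where
  "harmonic_poly n f \<longleftrightarrow> (\<Sum>i=1..n. partial_deriv i f) = 0"

text \<open>Points of \<open>{0,1}\<^sup>n\<close> are functions on \<open>nat\<close> that vanish outside \<open>{1..n}\<close>.\<close>

definition cube :: "nat \<Rightarrow> (nat \<Rightarrow> real) set" where
  "cube n = PiE_dflt {1..n} 0 (\<lambda>_. {0, 1})"

definition slice :: "nat \<Rightarrow> nat \<Rightarrow> (nat \<Rightarrow> real) set" where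
  "slice n k = {x \<in> cube n. (\<Sum>i=1..n. x i) = real k}"

text \<open>As \<open>pmf_of_set\<close> is unspecified on empty sets, \<open>nu n k\<close> is meaningful for \<open>k \<le> n\<close> only.\<close>

definition nu :: "nat \<Rightarrow> nat \<Rightarrow> (nat \<Rightarrow> real) pmf" where
  "nu n k = pmf_of_set (slice n k)"

definition mu :: "nat \<Rightarrow> real \<Rightarrow> (nat \<Rightarrow> real) pmf" where
  "mu n p = Pi_pmf {1..n} 0 (\<lambda>_. map_pmf of_bool (bernoulli_pmf p))"

definition norm_pmf :: "'a pmf \<Rightarrow> ('a \<Rightarrow> real) \<Rightarrow> real" where
  "norm_pmf M g = sqrt (measure_pmf.expectation M (\<lambda>x. (g x)\<^sup>2))"

lemma finite_cube: "finite (cube n)"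
  unfolding cube_def by (intro finite_PiE_dflt) auto

lemma finite_slice: "finite (slice n k)"
  unfolding slice_def using finite_cube by auto

lemma slice_nonempty:
  assumes "k \<le> n"
  shows "slice n k \<noteq> {}"
proof -
  let ?x = "\<lambda>i. of_bool (i \<in> {1..k}) :: real"
  have "(\<Sum>i=1..n. ?x i) = (\<Sum>i=1..k. 1)"
    using assms by (intro sum.mono_neutral_cong_right) auto
  then have "?x \<in> slice n k"
    using assms by (auto simp: slice_def cube_def PiE_dflt_def)
  then show ?thesis by blast
qed

text \<open>
  \<open>mu n p\<close> is the measure \<open>\<mu>\<^sub>p(x) = p\<^bsup>\<Sum>x\<^sub>i\<^esup> (1 - p)\<^bsup>\<Sum>(1 - x\<^sub>i)\<^esup>\<close>.
\<close>

lemma pmf_mu: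
  assumes "0 < p" "p < 1" "x \<in> cube n"
  shows "pmf (mu n p) x = p powr (\<Sum>i=1..n. x i) * (1 - p) powr (\<Sum>i=1..n. 1 - x i)"
proof -
  have pt: "pmf (map_pmf of_bool (bernoulli_pmf p)) (x i) = p powr x i * (1 - p) powr (1 - x i)"
    if "i \<in> {1..n}" for i
  proof -
    have inj: "inj (of_bool :: bool \<Rightarrow> real)" by (auto simp: inj_def)
    have "x i \<in> {0, 1}" using assms(3) that by (auto simp: cube_def PiE_dflt_def)
    have m: "pmf (map_pmf of_bool (bernoulli_pmf p)) (of_bool b :: real) = pmf (bernoulli_pmf p) b" for b
      by (rule pmf_map_inj'[OF inj])
    show ?thesis
      using m[of True] m[of False] \<open>x i \<in> {0, 1}\<close> assms by auto
  qed
  have "pmf (mu n p) x = (\<Prod>i=1..n. pmf (map_pmf of_bool (bernoulli_pmf p)) (x i))"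
    unfolding mu_def using assms(3) by (intro pmf_Pi') (auto simp: cube_def PiE_dflt_def)
  also have "\<dots> = (\<Prod>i=1..n. p powr x i * (1 - p) powr (1 - x i))"
    by (intro prod.cong refl pt)
  finally show ?thesis
    using assms by (simp add: prod.distrib powr_sum)
qed

end

theory Submission imports Defs begin

text \<open>
  On indicator vectors, a multilinear polynomial is \<open>F(A) = (\<Sum>S\<subseteq>A. c S)\<close>. The measure
  \<open>\<mu>\<^sub>p\<close> is the binomial mixture of the uniform measures on the layers of sets of size \<open>l\<close>, so the task
  is to compare the mean of \<open>(|F| - 1)\<^sup>2\<close> over the layer \<open>k = p n\<close> with its mean over a layer \<open>l\<close>. Draw
  a random pair of nested sets with sizes \<open>k\<close> and \<open>l\<close>. As \<open>x \<mapsto> |x| - 1\<close> is 1-Lipschitz, it suffices to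
  bound the mean of \<open>(F(A) - F(B))\<^sup>2\<close> over the pairs \<open>A \<subseteq> B\<close>.

  Harmonicity makes this second moment explicit. For an exchangeable pair \<open>A \<subseteq> B\<close>, the form \<open>E F(A) F(B)\<close>
  is diagonal in the coefficients: it is the sum over \<open>S\<close> of \<open>(c S)\<^sup>2\<close> times the probability that \<open>A\<close>
  contains \<open>S\<close> and \<open>B\<close> avoids \<open>S'\<close>, where \<open>S'\<close> is any set of size \<open>|S|\<close> disjoint from \<open>S\<close>
  (\<open>sum_subset_sum_product\<close>). Two consequences carry the proof.

  \<^item> The contribution of \<open>S\<close> to the mean of \<open>(F(A) - F(B))\<^sup>2\<close> is at most \<open>(c S)\<^sup>2\<close> times the probability that
    \<open>A\<close> and \<open>B\<close> differ somewhere on \<open>S \<union> S'\<close>, hence at most \<open>(c S)\<^sup>2\<close> times \<open>2 |S| |l - k| / n\<close>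
    (\<open>nested_difference_second_moment\<close>).

  \<^item> On the layer \<open>k\<close>, the weight of \<open>(c S)\<^sup>2\<close> in the second moment is at least \<open>(p (1 - p) / 4)\<^bsup>d\<^esup>\<close>, so the
    normalization bounds the sum of all \<open>(c S)\<^sup>2\<close> by \<open>(4 / (p (1 - p)))\<^bsup>d\<^esup>\<close> (\<open>coefficient_mass_bound\<close>). The
    bound on \<open>d\<close> ensures that \<open>2 d\<close> is at most \<open>k\<close> and \<open>n - k\<close>.

  Averaged over the binomial distribution of \<open>l\<close>, the distance \<open>|l - k|\<close> is at most its standard
  deviation \<open>\<sigma> = \<surd>(p (1 - p) n)\<close>, and \<open>\<sigma> / n = p (1 - p) / \<sigma>\<close>. So the mean square distance of the two
  values of \<open>F\<close> is at most of order \<open>(d / \<sigma>) (p (1 - p))\<^bsup>-2d\<^esup>\<close>, and by a weighted Cauchy-Schwarz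
  inequality the difference of the two expectations is of the order of its square root.
\<close>

section \<open>Sums of harmonic coefficients\<close>

text \<open>
  The sum in the definition is the coefficient of the monomial \<open>\<Prod>i\<in>T. x\<^sub>i\<close> in the sum of all partial
  derivatives of the multilinear polynomial with coefficients \<open>c\<close>.
\<close>

definition harmonic_on :: "'a set \<Rightarrow> ('a set \<Rightarrow> real) \<Rightarrow> bool" where
  "harmonic_on V c \<longleftrightarrow> (\<forall>T\<subseteq>V. (\<Sum>i\<in>V - T. c (insert i T)) = 0)"

definition layer :: "'a set \<Rightarrow> nat \<Rightarrow> 'a set set" where
  "layer V k = {A. A \<subseteq> V \<and> card A = k}"

lemma finite_layer [simp]: "finite V \<Longrightarrow> finite (layer V k)"
  by (simp add: layer_def)

lemma card_layer: "finite V \<Longrightarrow> card (layer V k) = card V choose k"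
  by (simp add: layer_def n_subsets)

lemma sum_Pow_layers:
  assumes "finite V"
  shows "(\<Sum>A\<in>Pow V. g A) = (\<Sum>k\<le>card V. \<Sum>A\<in>layer V k. g A)"
proof -
  have "(\<Sum>A\<in>Pow V. g A) = (\<Sum>k\<le>card V. \<Sum>A | A \<in> Pow V \<and> card A = k. g A)"
    using assms by (intro sum.group [symmetric]) (auto intro: card_mono)
  then show ?thesis by (simp add: layer_def)
qed

lemma layer_superset_same_card:
  assumes "finite V" "R \<subseteq> V" "card R = t"
  shows "{T \<in> layer V t. R \<subseteq> T} = {R}"
proof -
  have "T = R" if "T \<subseteq> V" "card T = t" "R \<subseteq> T" for T
    using that assms card_subset_eq[of T R] finite_subset by metis
  then show ?thesis using assms by (auto simp: layer_def)
qed

text \<open>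
  Double counting: a set \<open>T\<close> of size \<open>t\<close> above \<open>R\<close> lies above exactly \<open>t - |R|\<close> one-element extensions of
  \<open>R\<close>. Hence \<open>t - |R|\<close> times the sum at \<open>R\<close> is the total of the sums at these extensions. At \<open>|R| = t - 1\<close>
  that total is zero by harmonicity, and the zeros propagate down to smaller \<open>R\<close>.
\<close>

lemma harmonic_sum_supersets:
  assumes V: "finite V" and h: "harmonic_on V c"
  shows "R \<subseteq> V \<Longrightarrow> card R < t \<Longrightarrow> (\<Sum>T | T \<in> layer V t \<and> R \<subseteq> T. c T) = 0"
proof (induction "t - card R" arbitrary: R)
  case 0
  then show ?case by simp
next
  case (Suc j R)
  have fR: "finite R" using Suc.prems V finite_subset by blast
  let ?U = "\<lambda>R. {T \<in> layer V t. R \<subseteq> T}"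
  have "(real t - real (card R)) * (\<Sum>T\<in>?U R. c T) = (\<Sum>T\<in>?U R. \<Sum>i\<in>T - R. c T)"
    unfolding sum_distrib_left
  proof (rule sum.cong)
    fix T assume T: "T \<in> ?U R"
    then have "card (T - R) = t - card R"
      using card_Diff_subset[OF fR] by (auto simp: layer_def)
    then show "(real t - real (card R)) * c T = (\<Sum>i\<in>T - R. c T)"
      using Suc.prems by (simp add: of_nat_diff)
  qed simp
  also have "\<dots> = (\<Sum>T\<in>?U R. \<Sum>i | i \<in> V - R \<and> i \<in> T. c T)"
    by (intro sum.cong) (auto simp: layer_def)
  also have "\<dots> = (\<Sum>i\<in>V - R. \<Sum>T | T \<in> ?U R \<and> i \<in> T. c T)"
    using V by (intro sum.swap_restrict) auto
  also have "\<dots> = (\<Sum>i\<in>V - R. \<Sum>T\<in>?U (insert i R). c T)"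
    by (intro sum.cong) auto
  also have "\<dots> = 0"
  proof (cases "j = 0")
    case True
    have "(\<Sum>T\<in>?U (insert i R). c T) = c (insert i R)" if i: "i \<in> V - R" for i
    proof -
      have "card (insert i R) = t" using i fR Suc True by auto
      then have "?U (insert i R) = {insert i R}"
        using i Suc.prems V by (intro layer_superset_same_card) auto
      then show ?thesis by simp
    qed
    then show ?thesis using h Suc.prems by (simp add: harmonic_on_def)
  next
    case False
    then show ?thesis
      using Suc fR by (intro sum.neutral ballI Suc.hyps(1)) auto
  qed
  finally show ?case using Suc.prems by simp
qed

text \<open>
  The elements of \<open>Q\<close> are forbidden one at a time: the sets that avoid \<open>i\<close> are all sets without those
  that contain \<open>i\<close>. The unrestricted sum vanishes as its constraints are too few, so each step
  turns a forbidden element into a required one and changes the sign.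
\<close>

lemma harmonic_sum_separating:
  assumes V: "finite V" and h: "harmonic_on V c"
    and Q: "finite Q"
  shows "\<lbrakk>R \<subseteq> V; Q \<subseteq> V; R \<inter> Q = {}; card R + card Q \<le> t\<rbrakk> \<Longrightarrow>
    (\<Sum>T | T \<in> layer V t \<and> R \<subseteq> T \<and> T \<inter> Q = {}. c T)
      = (if card R + card Q = t then (-1) ^ card Q * c (R \<union> Q) else 0)"
  using Q
proof (induction Q arbitrary: R)
  case empty
  have "{T \<in> layer V t. R \<subseteq> T} = {R}" if "card R = t"
    using that empty.prems V by (intro layer_superset_same_card) auto
  then show ?case
    using harmonic_sum_supersets[OF V h, of R t] empty.prems by auto
next
  case (insert i Q R)
  let ?a = "\<lambda>R Q. \<Sum>T | T \<in> layer V t \<and> R \<subseteq> T \<and> T \<inter> Q = {}. c T"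
  have fR: "finite R" using insert.prems V finite_subset by blast
  have "?a R Q = ?a R (insert i Q) + ?a (insert i R) Q"
    using V by (subst sum.union_disjoint [symmetric]) (auto intro!: sum.cong)
  moreover have "?a R Q = 0"
    using insert by (subst insert.IH) auto
  moreover have "?a (insert i R) Q = (if card R + card (insert i Q) = t
      then (-1) ^ card Q * c (R \<union> insert i Q) else 0)"
    using insert fR by (subst insert.IH) auto
  ultimately show ?case using insert.hyps by (auto split: if_splits)
qed

text \<open>
  A set meets \<open>S\<close> exactly in \<open>R\<close> if it contains \<open>R\<close> and avoids \<open>S - R\<close>; these are \<open>|S|\<close> constraints in all.
  So \<open>S\<close> sees nothing of a higher degree, and of its own degree only the coefficient at \<open>S\<close> itself.
\<close>

lemma harmonic_sum_intersections:
  assumes V: "finite V" and h: "harmonic_on V c" and S: "S \<subseteq> V" "card S \<le> t"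
  shows "(\<Sum>T\<in>layer V t. c T * g (card (S \<inter> T)))
    = (if card S = t then c S * (\<Sum>R\<in>Pow S. (-1) ^ card (S - R) * g (card R)) else 0)"
proof -
  have fS: "finite S" using S V finite_subset by blast
  have "(\<Sum>T\<in>layer V t. c T * g (card (S \<inter> T)))
      = (\<Sum>R\<in>Pow S. \<Sum>T | T \<in> layer V t \<and> S \<inter> T = R. c T * g (card (S \<inter> T)))"
    using V fS by (intro sum.group [symmetric]) auto
  also have "\<dots> = (\<Sum>R\<in>Pow S. g (card R) *
      (\<Sum>T | T \<in> layer V t \<and> R \<subseteq> T \<and> T \<inter> (S - R) = {}. c T))"
    unfolding sum_distrib_left
  proof (intro sum.cong refl)
    fix R T assume "R \<in> Pow S" "T \<in> {T \<in> layer V t. R \<subseteq> T \<and> T \<inter> (S - R) = {}}"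
    then have "S \<inter> T = R" by auto
    then show "c T * g (card (S \<inter> T)) = g (card R) * c T" by simp
  qed auto
  also have "\<dots> = (\<Sum>R\<in>Pow S. g (card R) *
      (if card S = t then (-1) ^ card (S - R) * c S else 0))"
  proof (intro sum.cong refl)
    fix R assume R: "R \<in> Pow S"
    then have "card R + card (S - R) = card S"
      using fS card_Un_disjoint[of R "S - R"] by (auto simp: Un_absorb1 dest: finite_subset)
    moreover have "R \<union> (S - R) = S" using R by auto
    ultimately show "g (card R) * (\<Sum>T | T \<in> layer V t \<and> R \<subseteq> T \<and> T \<inter> (S - R) = {}. c T)
      = g (card R) * (if card S = t then (-1) ^ card (S - R) * c S else 0)"
      using R S fS harmonic_sum_separating[OF V h, of "S - R" R t] order_trans[OF _ S(1)] by auto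
  qed
  finally show ?thesis by (simp add: sum_distrib_left mult_ac)
qed

text \<open>
  A quadratic form whose kernel depends only on the sizes of two sets and of their intersection
  is diagonal on harmonic coefficients. This contains the orthogonality of different degrees:
  for \<open>|S| \<noteq> |T|\<close>, summing first over the larger of the two sets gives zero.
\<close>

lemma harmonic_quadratic_form:
  assumes V: "finite V" and h: "harmonic_on V c"
  shows "(\<Sum>S\<in>Pow V. \<Sum>T\<in>Pow V. c S * c T * g (card S) (card T) (card (S \<inter> T)))
    = (\<Sum>S\<in>Pow V. (c S)\<^sup>2 * (\<Sum>R\<in>Pow S. (-1) ^ card (S - R) * g (card S) (card S) (card R)))"
proof -
  let ?n = "card V"
  let ?B = "\<lambda>s t. \<Sum>S\<in>layer V s. \<Sum>T\<in>layer V t. c S * c T * g s t (card (S \<inter> T))"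
  let ?D = "\<lambda>S. (c S)\<^sup>2 * (\<Sum>R\<in>Pow S. (-1) ^ card (S - R) * g (card S) (card S) (card R))"
  have B: "?B s t = (if s = t then (\<Sum>S\<in>layer V s. ?D S) else 0)" for s t
  proof (cases "s \<le> t")
    case True
    have "?B s t = (\<Sum>S\<in>layer V s. c S * (\<Sum>T\<in>layer V t. c T * g s t (card (S \<inter> T))))"
      by (simp add: sum_distrib_left mult_ac)
    also have "\<dots> = (\<Sum>S\<in>layer V s. if s = t then ?D S else 0)"
      using True
      by (intro sum.cong refl, subst harmonic_sum_intersections[OF V h])
         (auto simp: layer_def power2_eq_square mult_ac)
    finally show ?thesis by simp
  next
    case False
    have "?B s t = (\<Sum>T\<in>layer V t. \<Sum>S\<in>layer V s. c S * c T * g s t (card (S \<inter> T)))"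
      by (rule sum.swap)
    also have "\<dots> = (\<Sum>T\<in>layer V t. c T * (\<Sum>S\<in>layer V s. c S * g s t (card (T \<inter> S))))"
      by (simp add: sum_distrib_left mult_ac Int_commute)
    also have "\<dots> = 0"
      using False
      by (intro sum.neutral ballI, subst harmonic_sum_intersections[OF V h])
         (auto simp: layer_def)
    finally show ?thesis using False by simp
  qed
  have "(\<Sum>S\<in>Pow V. \<Sum>T\<in>Pow V. c S * c T * g (card S) (card T) (card (S \<inter> T)))
      = (\<Sum>s\<le>?n. \<Sum>S\<in>layer V s. \<Sum>t\<le>?n. \<Sum>T\<in>layer V t.
          c S * c T * g (card S) (card T) (card (S \<inter> T)))"
    by (simp only: sum_Pow_layers[OF V])
  also have "\<dots> = (\<Sum>s\<le>?n. \<Sum>S\<in>layer V s. \<Sum>t\<le>?n. \<Sum>T\<in>layer V t.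
          c S * c T * g s t (card (S \<inter> T)))"
    by (intro sum.cong refl) (auto simp: layer_def)
  also have "\<dots> = (\<Sum>s\<le>?n. \<Sum>t\<le>?n. ?B s t)"
    by (intro sum.cong refl sum.swap)
  also have "\<dots> = (\<Sum>s\<le>?n. \<Sum>S\<in>layer V s. ?D S)"
    by (simp add: B)
  finally show ?thesis by (simp only: sum_Pow_layers[OF V])
qed

section \<open>Correlations at exchangeable pairs of sets\<close>

text \<open>
  The value at the indicator vector of \<open>A\<close> of the multilinear polynomial with coefficients \<open>c\<close>: a
  squarefree monomial is \<open>1\<close> there if its variables all lie in \<open>A\<close>, and \<open>0\<close> otherwise.
\<close>

definition subset_sum :: "('a set \<Rightarrow> real) \<Rightarrow> 'a set \<Rightarrow> real" where
  "subset_sum c A = (\<Sum>S\<in>Pow A. c S)"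

lemma subset_sum_indicator:
  assumes "finite V" "A \<subseteq> V"
  shows "subset_sum c A = (\<Sum>S\<in>Pow V. c S * of_bool (S \<subseteq> A))"
  using assms unfolding subset_sum_def
  by (intro sum.mono_neutral_cong_left) auto

text \<open>
  The expansion of the product of the factors \<open>1 - [x \<in> B]\<close> over \<open>x \<in> U\<close>.
\<close>

lemma sum_Pow_alternating_disjoint:
  assumes "finite U"
  shows "(\<Sum>Q\<in>Pow U. (-1) ^ card Q * of_bool (Q \<subseteq> B)) = (of_bool (U \<inter> B = {}) :: real)"
proof -
  have "(\<Sum>Q\<in>Pow U. (-1) ^ card Q * of_bool (Q \<subseteq> B)) = (\<Sum>Q\<in>Pow (U \<inter> B). (-1) ^ card Q :: real)"
    using assms by (intro sum.mono_neutral_cong_right) auto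
  also have "\<dots> = (\<Prod>x\<in>U \<inter> B. (-1) + 1)"
    using assms by (subst prod_add) auto
  finally show ?thesis using assms by auto
qed

text \<open>
  Correlations of a harmonic polynomial at an exchangeable pair \<open>X \<subseteq> Y\<close> of random sets. For such a
  pair the probability of \<open>S \<subseteq> X\<close> and \<open>T \<subseteq> Y\<close> is that of \<open>S \<subseteq> X\<close> and \<open>S \<union> T \<subseteq> Y\<close>, a function of
  \<open>|S|\<close> and \<open>|S \<union> T|\<close>, so the quadratic form is diagonal. Its diagonal entry is an alternating sum
  that inclusion-exclusion, over a disjoint copy \<open>U S\<close> of \<open>S\<close>, turns into the probability that
  \<open>X\<close> contains \<open>S\<close> while \<open>Y\<close> avoids \<open>U S\<close>.
\<close>

lemma sum_subset_sum_product:
  assumes V: "finite V" and h: "harmonic_on V c"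
    and X: "\<And>\<omega>. \<omega> \<in> \<Omega> \<Longrightarrow> X \<omega> \<subseteq> Y \<omega>" and Y: "\<And>\<omega>. \<omega> \<in> \<Omega> \<Longrightarrow> Y \<omega> \<subseteq> V"
    and g: "\<And>S T. S \<subseteq> T \<Longrightarrow> T \<subseteq> V \<Longrightarrow>
      (\<Sum>\<omega>\<in>\<Omega>. of_bool (S \<subseteq> X \<omega> \<and> T \<subseteq> Y \<omega>)) = (g (card S) (card T) :: real)"
    and U: "\<And>S. S \<subseteq> V \<Longrightarrow> c S \<noteq> 0 \<Longrightarrow> U S \<subseteq> V - S \<and> card (U S) = card S"
  shows "(\<Sum>\<omega>\<in>\<Omega>. subset_sum c (X \<omega>) * subset_sum c (Y \<omega>))
    = (\<Sum>S\<in>Pow V. (c S)\<^sup>2 * (\<Sum>\<omega>\<in>\<Omega>. of_bool (S \<subseteq> X \<omega> \<and> U S \<inter> Y \<omega> = {})))"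
proof -
  let ?b = "\<lambda>S T. \<Sum>\<omega>\<in>\<Omega>. of_bool (S \<subseteq> X \<omega> \<and> T \<subseteq> Y \<omega>) :: real"
  have b: "?b S T = g (card S) (card S + card T - card (S \<inter> T))"
    if "S \<in> Pow V" "T \<in> Pow V" for S T
  proof -
    \<comment> \<open>\<open>S \<subseteq> X\<close> already forces \<open>S \<subseteq> Y\<close>.\<close>
    have "?b S T = ?b S (S \<union> T)"
      using X by (intro sum.cong refl arg_cong[where f = of_bool]) blast
    moreover have "card (S \<union> T) = card S + card T - card (S \<inter> T)"
      using card_Un_Int[of S T] that V finite_subset[of S V] finite_subset[of T V] by simp
    ultimately show ?thesis using g[of S "S \<union> T"] that by simp
  qed
  have "(\<Sum>\<omega>\<in>\<Omega>. subset_sum c (X \<omega>) * subset_sum c (Y \<omega>))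
      = (\<Sum>\<omega>\<in>\<Omega>. \<Sum>S\<in>Pow V. \<Sum>T\<in>Pow V. c S * c T * of_bool (S \<subseteq> X \<omega> \<and> T \<subseteq> Y \<omega>))"
  proof (intro sum.cong refl)
    fix \<omega> assume "\<omega> \<in> \<Omega>"
    then have "X \<omega> \<subseteq> V" "Y \<omega> \<subseteq> V" using X Y by blast+
    then show "subset_sum c (X \<omega>) * subset_sum c (Y \<omega>)
        = (\<Sum>S\<in>Pow V. \<Sum>T\<in>Pow V. c S * c T * of_bool (S \<subseteq> X \<omega> \<and> T \<subseteq> Y \<omega>))"
      using V by (simp only: subset_sum_indicator sum_product of_bool_conj mult_ac)
  qed
  also have "\<dots> = (\<Sum>S\<in>Pow V. \<Sum>T\<in>Pow V. c S * c T * ?b S T)"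
    unfolding sum_distrib_left
    by (subst sum.swap, intro sum.cong refl, rule sum.swap)
  also have "\<dots> = (\<Sum>S\<in>Pow V. \<Sum>T\<in>Pow V. c S * c T * g (card S) (card S + card T - card (S \<inter> T)))"
    by (intro sum.cong refl) (simp only: b)
  also have "\<dots> = (\<Sum>S\<in>Pow V. (c S)\<^sup>2 *
      (\<Sum>R\<in>Pow S. (-1) ^ card (S - R) * g (card S) (card S + card S - card R)))"
    by (rule harmonic_quadratic_form[OF V h, where g = "\<lambda>s t r. g s (s + t - r)"])
  also have "\<dots> = (\<Sum>S\<in>Pow V. (c S)\<^sup>2 * (\<Sum>\<omega>\<in>\<Omega>. of_bool (S \<subseteq> X \<omega> \<and> U S \<inter> Y \<omega> = {})))"
  proof (intro sum.cong refl)
    fix S assume S: "S \<in> Pow V"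
    show "(c S)\<^sup>2 * (\<Sum>R\<in>Pow S. (-1) ^ card (S - R) * g (card S) (card S + card S - card R))
      = (c S)\<^sup>2 * (\<Sum>\<omega>\<in>\<Omega>. of_bool (S \<subseteq> X \<omega> \<and> U S \<inter> Y \<omega> = {}))"
    proof (cases "c S = 0")
      case False
      then have US: "U S \<subseteq> V - S" "card (U S) = card S" using U S by auto
      have fin: "finite S" "finite (U S)" using S US V by (auto dest: finite_subset)
      obtain \<phi> where \<phi>: "bij_betw \<phi> (U S) S"
        using fin US finite_same_card_bij by blast
      have card\<phi>: "card (\<phi> ` Q) = card Q" if "Q \<in> Pow (U S)" for Q
        using that \<phi> by (intro card_image) (auto simp: bij_betw_def dest: inj_on_subset)
      \<comment> \<open>Pass to the complement in \<open>S\<close> and transport it to the disjoint copy along a bijection.\<close>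
      have "(\<Sum>R\<in>Pow S. (-1) ^ card (S - R) * g (card S) (card S + card S - card R))
          = (\<Sum>R\<in>Pow S. (-1) ^ card R * g (card S) (card S + card R))"
        using fin
        by (intro sum.reindex_bij_witness[of _ "\<lambda>R. S - R" "\<lambda>R. S - R"])
           (auto simp: double_diff card_Diff_subset finite_subset card_mono)
      also have "\<dots> = (\<Sum>Q\<in>Pow (U S). (-1) ^ card (\<phi> ` Q) * g (card S) (card S + card (\<phi> ` Q)))"
        by (rule sum.reindex_bij_betw[OF bij_betw_Pow[OF \<phi>], symmetric])
      also have "\<dots> = (\<Sum>Q\<in>Pow (U S). (-1) ^ card Q * g (card S) (card (S \<union> Q)))"
      proof (intro sum.cong refl)
        fix Q assume Q: "Q \<in> Pow (U S)"
        then have "card (S \<union> Q) = card S + card Q"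
          using US fin by (intro card_Un_disjoint) (auto dest: finite_subset)
        then show "(-1) ^ card (\<phi> ` Q) * g (card S) (card S + card (\<phi> ` Q))
            = (-1) ^ card Q * g (card S) (card (S \<union> Q))"
          using card\<phi>[OF Q] by simp
      qed
      also have "\<dots> = (\<Sum>Q\<in>Pow (U S). (-1) ^ card Q * ?b S (S \<union> Q))"
        using S US by (intro sum.cong refl) (subst g, auto)
      also have "\<dots> = (\<Sum>Q\<in>Pow (U S). \<Sum>\<omega>\<in>\<Omega>. of_bool (S \<subseteq> X \<omega>) * ((-1) ^ card Q * of_bool (Q \<subseteq> Y \<omega>)))"
        unfolding sum_distrib_left using X by (intro sum.cong refl) auto
      also have "\<dots> = (\<Sum>\<omega>\<in>\<Omega>. of_bool (S \<subseteq> X \<omega>) *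
          (\<Sum>Q\<in>Pow (U S). (-1) ^ card Q * of_bool (Q \<subseteq> Y \<omega>)))"
        unfolding sum_distrib_left by (rule sum.swap)
      also have "\<dots> = (\<Sum>\<omega>\<in>\<Omega>. of_bool (S \<subseteq> X \<omega> \<and> U S \<inter> Y \<omega> = {}))"
        using fin by (simp only: sum_Pow_alternating_disjoint of_bool_conj)
      finally show ?thesis by simp
    qed simp
  qed
  finally show ?thesis .
qed

section \<open>Nested pairs of sets\<close>

text \<open>
  Counted through complements, so that both sides are \<open>0\<close> when \<open>T\<close> has more than \<open>k\<close> elements; a
  lower index \<open>k - card T\<close> would be truncated to \<open>0\<close> and give \<open>1\<close>.
\<close>

lemma card_layer_supersets:
  assumes V: "finite V" and T: "T \<subseteq> V" and k: "k \<le> card V"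
  shows "card {A \<in> layer V k. T \<subseteq> A} = (card V - card T) choose (card V - k)"
proof -
  have "bij_betw (\<lambda>A. V - A) {A \<in> layer V k. T \<subseteq> A} (layer (V - T) (card V - k))"
    using V T k
    by (intro bij_betwI[where g = "\<lambda>A. V - A"])
       (auto simp: layer_def card_Diff_subset finite_subset[OF _ V] subset_iff)
  then have "card {A \<in> layer V k. T \<subseteq> A} = card (layer (V - T) (card V - k))"
    by (rule bij_betw_same_card)
  then show ?thesis
    using V T by (simp add: card_layer card_Diff_subset finite_subset)
qed

lemma sum_layer_supersets:
  assumes "finite V" "T \<subseteq> V" "k \<le> card V"
  shows "(\<Sum>A\<in>layer V k. of_bool (T \<subseteq> A)) = (real ((card V - card T) choose (card V - k)))"
  using card_layer_supersets[OF assms] assms(1)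
  by (simp add: of_bool_def flip: sum.inter_filter)

lemma sum_layer_separating:
  assumes V: "finite V" and S: "S \<subseteq> V" and U: "U \<subseteq> V - S" "card U = card S"
    and k: "k + card S \<le> card V"
  shows "(\<Sum>A\<in>layer V k. of_bool (S \<subseteq> A \<and> U \<inter> A = {}))
    = real ((card V - 2 * card S) choose (card V - card S - k))"
proof -
  have cU: "card (V - U) = card V - card S"
    using V U by (subst card_Diff_subset) (auto dest: finite_subset)
  have "(\<Sum>A\<in>layer V k. of_bool (S \<subseteq> A \<and> U \<inter> A = {})) = (\<Sum>A\<in>layer (V - U) k. of_bool (S \<subseteq> A) :: real)"
    using V by (intro sum.mono_neutral_cong_right) (auto simp: layer_def)
  also have "\<dots> = real ((card (V - U) - card S) choose (card (V - U) - k))"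
    using V S U k cU by (intro sum_layer_supersets) auto
  finally show ?thesis by (simp add: cU mult_2)
qed

text \<open>
  The uniform distribution on these pairs, larger set first, couples the uniform distributions on
  the layers \<open>M\<close> and \<open>m\<close>.
\<close>

definition nested :: "'a set \<Rightarrow> nat \<Rightarrow> nat \<Rightarrow> ('a set \<times> 'a set) set" where
  "nested V m M = (SIGMA B:layer V M. layer B m)"

lemma nested_D: "(B, A) \<in> nested V m M \<Longrightarrow> A \<subseteq> B \<and> B \<subseteq> V"
  by (auto simp: nested_def layer_def)

lemma sum_nested:
  assumes "finite V"
  shows "(\<Sum>\<omega>\<in>nested V m M. h \<omega>) = (\<Sum>B\<in>layer V M. \<Sum>A\<in>layer B m. h (B, A))"
  unfolding nested_def using assms
  by (subst sum.Sigma) (auto simp: layer_def dest: finite_subset)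

lemma sum_nested_upper:
  fixes h :: "'a set \<Rightarrow> real"
  assumes "finite V"
  shows "(\<Sum>\<omega>\<in>nested V m M. h (fst \<omega>)) = real (M choose m) * (\<Sum>B\<in>layer V M. h B)"
proof -
  have "(\<Sum>\<omega>\<in>nested V m M. h (fst \<omega>)) = (\<Sum>B\<in>layer V M. real (card (layer B m)) * h B)"
    using assms by (simp add: sum_nested)
  also have "\<dots> = (\<Sum>B\<in>layer V M. real (M choose m) * h B)"
  proof (intro sum.cong refl)
    fix B assume "B \<in> layer V M"
    then have "finite B" "card B = M" using assms finite_subset by (auto simp: layer_def)
    then show "real (card (layer B m)) * h B = real (M choose m) * h B" by (simp add: card_layer)
  qed
  finally show ?thesis by (simp add: sum_distrib_left)
qed

lemma sum_nested_lower:
  fixes h :: "'a set \<Rightarrow> real"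
  assumes V: "finite V" and M: "M \<le> card V"
  shows "(\<Sum>\<omega>\<in>nested V m M. h (snd \<omega>))
    = real ((card V - m) choose (card V - M)) * (\<Sum>A\<in>layer V m. h A)"
proof -
  have "(\<Sum>\<omega>\<in>nested V m M. h (snd \<omega>)) = (\<Sum>B\<in>layer V M. \<Sum>A | A \<in> layer V m \<and> A \<subseteq> B. h A)"
    unfolding sum_nested[OF V]
    by (intro sum.cong) (auto simp: layer_def)
  also have "\<dots> = (\<Sum>A\<in>layer V m. \<Sum>B | B \<in> layer V M \<and> A \<subseteq> B. h A)"
    using V by (intro sum.swap_restrict) auto
  also have "\<dots> = (\<Sum>A\<in>layer V m. real ((card V - m) choose (card V - M)) * h A)"
  proof (intro sum.cong refl)
    fix A assume "A \<in> layer V m"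
    then have "A \<subseteq> V" "card A = m" by (auto simp: layer_def)
    then show "(\<Sum>B | B \<in> layer V M \<and> A \<subseteq> B. h A) = real ((card V - m) choose (card V - M)) * h A"
      using card_layer_supersets[OF V _ M, of A] by simp
  qed
  finally show ?thesis by (simp add: sum_distrib_left)
qed

lemma card_nested:
  assumes "finite V"
  shows "card (nested V m M) = (card V choose M) * (M choose m)"
proof -
  have "real (card (nested V m M)) = real ((card V choose M) * (M choose m))"
    using sum_nested_upper[OF assms, of "\<lambda>_. 1" m M] assms by (simp add: card_layer)
  then show ?thesis by linarith
qed

text \<open>
  By symmetry every point is equally likely to lie in the \<open>M - m\<close> element difference \<open>B - A\<close>.
\<close>

lemma sum_nested_differ_at:
  assumes V: "finite V" and i: "i \<in> V" and m: "m \<le> M" and M: "M \<le> card V"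
  shows "(\<Sum>(B, A)\<in>nested V m M. of_bool (i \<in> B - A))
    = (real M - real m) / real (card V) * real (card (nested V m M))"
proof (cases "M = 0")
  case True
  then have "i \<notin> B - A" if "(B, A) \<in> nested V m M" for A B
    using that V by (auto simp: nested_def layer_def card_eq_0_iff dest: finite_subset)
  then show ?thesis using True m by (auto intro!: sum.neutral)
next
  case False
  let ?n = "card V"
  have n: "?n > 0" using V i card_gt_0_iff by blast
  have inner: "(\<Sum>A\<in>layer B m. of_bool (i \<in> B - A)) = of_bool ({i} \<subseteq> B) * real ((M - 1) choose m)"
    if B: "B \<in> layer V M" for B
  proof (cases "i \<in> B")
    case True
    have fB: "finite B" using B V finite_subset by (auto simp: layer_def)
    have "(\<Sum>A\<in>layer B m. of_bool (i \<in> B - A)) = (\<Sum>A\<in>layer (B - {i}) m. 1::real)"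
      using True fB by (intro sum.mono_neutral_cong_right) (auto simp: layer_def)
    also have "\<dots> = real (card (layer (B - {i}) m))" by simp
    also have "\<dots> = real ((M - 1) choose m)"
      using True fB B by (subst card_layer) (auto simp: layer_def)
    finally show ?thesis using True by simp
  qed simp
  have "(\<Sum>(B, A)\<in>nested V m M. of_bool (i \<in> B - A))
      = (\<Sum>B\<in>layer V M. of_bool ({i} \<subseteq> B) * real ((M - 1) choose m))"
    using V inner by (simp add: sum_nested)
  also have "\<dots> = real ((?n - 1) choose (?n - M)) * real ((M - 1) choose m)"
    using sum_layer_supersets[OF V, of "{i}" M] i M by (simp flip: sum_distrib_right)
  finally have sum: "(\<Sum>(B, A)\<in>nested V m M. of_bool (i \<in> B - A)) = \<dots>" .
  have 1: "M * (?n choose M) = ?n * ((?n - 1) choose (?n - M))"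
    using binomial_absorb_comp[of ?n "?n - M"] M by (simp add: binomial_symmetric[symmetric])
  have 2: "(M - m) * (M choose m) = M * ((M - 1) choose m)"
    by (rule binomial_absorb_comp)
  have "M * (?n * (((?n - 1) choose (?n - M)) * ((M - 1) choose m)))
      = (?n * ((?n - 1) choose (?n - M))) * (M * ((M - 1) choose m))"
    by (simp add: mult_ac)
  also have "\<dots> = M * ((M - m) * card (nested V m M))"
    unfolding 1[symmetric] 2[symmetric] card_nested[OF V] by (simp add: mult_ac)
  finally have "?n * (((?n - 1) choose (?n - M)) * ((M - 1) choose m)) = (M - m) * card (nested V m M)"
    using False by simp
  then have "real ?n * (real ((?n - 1) choose (?n - M)) * real ((M - 1) choose m))
      = (real M - real m) * real (card (nested V m M))"
    using m by (simp only: of_nat_mult[symmetric] of_nat_diff[symmetric])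
  then show ?thesis using sum n by (simp add: field_simps)
qed

section \<open>Second moments on layers and on nested pairs\<close>

text \<open>
  The probability that a uniform \<open>k\<close>-set contains \<open>s\<close> given points and avoids \<open>s\<close> others is about
  \<open>(k (n - k) / n\<^sup>2)\<^bsup>s\<^esup>\<close>. Each additional pair of points contributes a factor \<open>(k - s) (n - k - s)\<close> over at
  most \<open>n\<^sup>2\<close>, and as long as \<open>s\<close> is at most half of \<open>k\<close> and of \<open>n - k\<close>, the two halvings cost at most a
  factor \<open>4\<close>.
\<close>

lemma choose_central_ratio:
  assumes k: "2 * d \<le> k" and nk: "2 * d + k \<le> n" and s: "s \<le> d"
  shows "(real k * (real n - real k) / (4 * (real n)\<^sup>2)) ^ s * real (n choose k)
    \<le> real ((n - 2 * s) choose (n - s - k))"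
  using s
proof (induction s)
  case 0
  then show ?case using binomial_symmetric[of k n] nk by simp
next
  case (Suc s)
  let ?r = "real k * (real n - real k) / (4 * (real n)\<^sup>2)"
  define N where "N = n - 2 * s"
  define K where "K = n - s - k"
  have NK: "K \<ge> 1" "N - K \<ge> 1" "N \<ge> 2" "K \<le> N" "N - K = k - s"
    using Suc.prems k nk by (auto simp: N_def K_def)
  obtain N' K' where N': "N = Suc (Suc N')" and K': "K = Suc K'"
    using NK that[of "N - 2" "K - 1"] by simp
  have "Suc K' * (Suc (Suc N') - Suc K') * (Suc (Suc N') choose Suc K')
      = Suc (Suc N') * Suc N' * (N' choose K')"
  proof -
    have "Suc K' * (Suc (Suc N') - Suc K') * (Suc (Suc N') choose Suc K')
        = (Suc N' - K') * (Suc K' * (Suc (Suc N') choose Suc K'))"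
      by (simp only: diff_Suc_Suc mult_ac)
    also have "\<dots> = Suc (Suc N') * ((Suc N' - K') * (Suc N' choose K'))"
      by (simp only: binomial_absorption mult_ac diff_Suc_1)
    also have "\<dots> = Suc (Suc N') * (Suc N' * (N' choose K'))"
      using binomial_absorb_comp[of "Suc N'" K'] by simp
    finally show ?thesis by (simp only: mult.assoc)
  qed
  then have "real (K * (N - K) * (N choose K)) = real (N * (N - 1) * ((N - 2) choose (K - 1)))"
    by (simp only: N' K') simp
  then have eq: "real K * real (k - s) * real (N choose K)
      = real N * real (N - 1) * real ((N - 2) choose (K - 1))"
    by (simp only: NK(5) of_nat_mult)
  have "?r ^ Suc s * real (n choose k) \<le> ?r * real (N choose K)"
  proof -
    have "?r ^ s * real (n choose k) \<le> real (N choose K)"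
      unfolding N_def K_def using Suc by simp
    moreover have "?r \<ge> 0" using nk by simp
    ultimately show ?thesis unfolding power_Suc mult.assoc by (rule mult_left_mono)
  qed
  also have "\<dots> \<le> real ((N - 2) choose (K - 1))"
  proof -
    have n: "real n > 0" using NK by (simp add: N_def)
    have "real k / 2 \<le> real (k - s)" "(real n - real k) / 2 \<le> real K"
      using Suc.prems k nk by (auto simp: K_def of_nat_diff)
    then have "(real k / 2) * ((real n - real k) / 2) \<le> real (k - s) * real K"
      using nk by (intro mult_mono) auto
    then have "real k * (real n - real k) / 4 * real (N choose K)
        \<le> real K * real (k - s) * real (N choose K)"
      by (intro mult_right_mono) (auto simp: mult_ac)
    also have "\<dots> \<le> (real n)\<^sup>2 * real ((N - 2) choose (K - 1))"
      unfolding eq power2_eq_square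
      by (intro mult_right_mono mult_mono) (auto simp: N_def)
    finally show ?thesis using n by (simp add: field_simps)
  qed
  finally show ?case
    using Suc.prems by (simp add: N_def K_def)
qed

lemma ex_disjoint_copies:
  assumes V: "finite V" and d: "\<And>S. S \<subseteq> V \<Longrightarrow> c S \<noteq> 0 \<Longrightarrow> card S \<le> d" and n: "2 * d \<le> card V"
  shows "\<exists>U. \<forall>S\<subseteq>V. c S \<noteq> (0::real) \<longrightarrow> U S \<subseteq> V - S \<and> card (U S) = card S"
proof -
  have "\<exists>U. U \<subseteq> V - S \<and> card U = card S" if "S \<subseteq> V" "c S \<noteq> 0" for S
  proof -
    have "card S \<le> card (V - S)"
      using d[OF that] n that(1) V by (simp add: card_Diff_subset finite_subset)
    then show ?thesis by (meson obtain_subset_with_card_n)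
  qed
  then show ?thesis by metis
qed

text \<open>
  On a single layer, the second moment is the sum of the squares \<open>(c S)\<^sup>2\<close>, each weighted with the
  probability of containing \<open>S\<close> and avoiding its disjoint copy.
\<close>

lemma layer_second_moment:
  assumes V: "finite V" and h: "harmonic_on V c"
    and d: "\<And>S. S \<subseteq> V \<Longrightarrow> c S \<noteq> 0 \<Longrightarrow> card S \<le> d"
    and k: "2 * d \<le> k" and nk: "2 * d + k \<le> card V"
  defines "r \<equiv> real k * (real (card V) - real k) / (4 * (real (card V))\<^sup>2)"
  assumes r: "r \<le> 1"
  shows "r ^ d * (\<Sum>S\<in>Pow V. (c S)\<^sup>2) * real (card (layer V k)) \<le> (\<Sum>A\<in>layer V k. (subset_sum c A)\<^sup>2)"
proof -
  have n: "2 * d \<le> card V" using nk by linarith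
  obtain U where U: "\<And>S. S \<subseteq> V \<Longrightarrow> c S \<noteq> 0 \<Longrightarrow> U S \<subseteq> V - S \<and> card (U S) = card S"
    using ex_disjoint_copies[where c = c, OF V d n] by blast
  have r0: "r \<ge> 0" using nk by (simp add: r_def)
  have "(\<Sum>A\<in>layer V k. (subset_sum c A)\<^sup>2)
      = (\<Sum>S\<in>Pow V. (c S)\<^sup>2 * (\<Sum>A\<in>layer V k. of_bool (S \<subseteq> A \<and> U S \<inter> A = {})))"
    unfolding power2_eq_square[of "subset_sum c _"]
  proof (rule sum_subset_sum_product[OF V h _ _ _ U])
    fix S T :: "'a set" assume ST: "S \<subseteq> T" "T \<subseteq> V"
    have "(\<Sum>A\<in>layer V k. of_bool (S \<subseteq> A \<and> T \<subseteq> A)) = (\<Sum>A\<in>layer V k. of_bool (T \<subseteq> A) :: real)"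
      using ST by (intro sum.cong refl arg_cong[where f = of_bool]) auto
    then show "(\<Sum>A\<in>layer V k. of_bool (S \<subseteq> A \<and> T \<subseteq> A))
        = (\<lambda>_ t. real ((card V - t) choose (card V - k))) (card S) (card T)"
      using ST nk sum_layer_supersets[OF V, of T k] by simp
  qed (auto simp: layer_def)
  also have "\<dots> \<ge> (\<Sum>S\<in>Pow V. (c S)\<^sup>2 * (r ^ d * real (card (layer V k))))"
  proof (intro sum_mono)
    fix S assume S: "S \<in> Pow V"
    show "(c S)\<^sup>2 * (r ^ d * real (card (layer V k)))
        \<le> (c S)\<^sup>2 * (\<Sum>A\<in>layer V k. of_bool (S \<subseteq> A \<and> U S \<inter> A = {}))"
    proof (cases "c S = 0")
      case False
      then have cS: "card S \<le> d" and US: "U S \<subseteq> V - S" "card (U S) = card S"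
        using S d U by auto
      have "r ^ d * real (card V choose k) \<le> r ^ card S * real (card V choose k)"
        using r0 r cS by (intro mult_right_mono power_decreasing) auto
      also have "\<dots> \<le> real ((card V - 2 * card S) choose (card V - card S - k))"
        unfolding r_def by (rule choose_central_ratio[OF k nk cS])
      also have "\<dots> = (\<Sum>A\<in>layer V k. of_bool (S \<subseteq> A \<and> U S \<inter> A = {}))"
        using V S US cS nk by (subst sum_layer_separating) auto
      finally show ?thesis using V by (intro mult_left_mono) (simp_all add: card_layer)
    qed simp
  qed
  finally show ?thesis by (simp add: sum_distrib_left sum_distrib_right mult_ac)
qed

text \<open>
  Expanding the square gives, for each \<open>S\<close> with disjoint copy \<open>U\<close>, the probability that \<open>B\<close> contains
  \<open>S\<close> and avoids \<open>U\<close>, plus the same for \<open>A\<close>, minus twice the probability that \<open>A\<close> contains \<open>S\<close> and \<open>B\<close>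
  avoids \<open>U\<close>. As \<open>A \<subseteq> B\<close>, the last event is the intersection of the other two, so what remains is the
  probability that exactly one of them occurs. This forces \<open>A\<close> and \<open>B\<close> to differ at one of the \<open>2 |S|\<close>
  points of \<open>S \<union> U\<close>.
\<close>

lemma nested_difference_second_moment:
  assumes V: "finite V" and h: "harmonic_on V c"
    and d: "\<And>S. S \<subseteq> V \<Longrightarrow> c S \<noteq> 0 \<Longrightarrow> card S \<le> d" and n: "2 * d \<le> card V"
    and m: "m \<le> M" and M: "M \<le> card V"
  shows "(\<Sum>(B, A)\<in>nested V m M. (subset_sum c B - subset_sum c A)\<^sup>2)
    \<le> 2 * real d * ((real M - real m) / real (card V)) * (\<Sum>S\<in>Pow V. (c S)\<^sup>2) * real (card (nested V m M))"
proof -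
  obtain U where U: "\<And>S. S \<subseteq> V \<Longrightarrow> c S \<noteq> 0 \<Longrightarrow> U S \<subseteq> V - S \<and> card (U S) = card S"
    using ex_disjoint_copies[where c = c, OF V d n] by blast
  let ?P = "nested V m M" and ?n = "card V" and ?F = "subset_sum c"
  let ?D = "(real M - real m) / real ?n * real (card ?P)"
  have D: "?D \<ge> 0" using m by simp
  have P: "snd \<omega> \<subseteq> fst \<omega>" "fst \<omega> \<subseteq> V" "snd \<omega> \<subseteq> V" if "\<omega> \<in> ?P" for \<omega>
    using nested_D[of "fst \<omega>" "snd \<omega>" V m M] that by (simp_all, blast)
  have BB: "(\<Sum>\<omega>\<in>?P. ?F (fst \<omega>) * ?F (fst \<omega>))
      = (\<Sum>S\<in>Pow V. (c S)\<^sup>2 * (\<Sum>\<omega>\<in>?P. of_bool (S \<subseteq> fst \<omega> \<and> U S \<inter> fst \<omega> = {})))"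
  proof (rule sum_subset_sum_product[OF V h _ _ _ U])
    fix S T :: "'a set" assume ST: "S \<subseteq> T" "T \<subseteq> V"
    have "(\<Sum>\<omega>\<in>?P. of_bool (S \<subseteq> fst \<omega> \<and> T \<subseteq> fst \<omega>)) = (\<Sum>\<omega>\<in>?P. of_bool (T \<subseteq> fst \<omega>) :: real)"
      using ST by (intro sum.cong refl arg_cong[where f = of_bool]) auto
    also have "\<dots> = real (M choose m) * real ((?n - card T) choose (?n - M))"
      using sum_nested_upper[OF V, of "\<lambda>B. of_bool (T \<subseteq> B)"] sum_layer_supersets[OF V ST(2) M] by simp
    finally show "(\<Sum>\<omega>\<in>?P. of_bool (S \<subseteq> fst \<omega> \<and> T \<subseteq> fst \<omega>))
        = (\<lambda>_ t. real (M choose m) * real ((?n - t) choose (?n - M))) (card S) (card T)" .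
  qed (use P in blast)+
  have AA: "(\<Sum>\<omega>\<in>?P. ?F (snd \<omega>) * ?F (snd \<omega>))
      = (\<Sum>S\<in>Pow V. (c S)\<^sup>2 * (\<Sum>\<omega>\<in>?P. of_bool (S \<subseteq> snd \<omega> \<and> U S \<inter> snd \<omega> = {})))"
  proof (rule sum_subset_sum_product[OF V h _ _ _ U])
    fix S T :: "'a set" assume ST: "S \<subseteq> T" "T \<subseteq> V"
    have "(\<Sum>\<omega>\<in>?P. of_bool (S \<subseteq> snd \<omega> \<and> T \<subseteq> snd \<omega>)) = (\<Sum>\<omega>\<in>?P. of_bool (T \<subseteq> snd \<omega>) :: real)"
      using ST by (intro sum.cong refl arg_cong[where f = of_bool]) auto
    also have "\<dots> = real ((?n - m) choose (?n - M)) * real ((?n - card T) choose (?n - m))"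
      using sum_nested_lower[OF V M, of "\<lambda>B. of_bool (T \<subseteq> B)"] sum_layer_supersets[OF V ST(2), of m] m M
      by simp
    finally show "(\<Sum>\<omega>\<in>?P. of_bool (S \<subseteq> snd \<omega> \<and> T \<subseteq> snd \<omega>))
        = (\<lambda>_ t. real ((?n - m) choose (?n - M)) * real ((?n - t) choose (?n - m))) (card S) (card T)" .
  qed (use P in blast)+
  have AB: "(\<Sum>\<omega>\<in>?P. ?F (snd \<omega>) * ?F (fst \<omega>))
      = (\<Sum>S\<in>Pow V. (c S)\<^sup>2 * (\<Sum>\<omega>\<in>?P. of_bool (S \<subseteq> snd \<omega> \<and> U S \<inter> fst \<omega> = {})))"
  proof (rule sum_subset_sum_product[OF V h _ _ _ U])
    fix S T :: "'a set" assume ST: "S \<subseteq> T" "T \<subseteq> V"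
    have "(\<Sum>\<omega>\<in>?P. of_bool (S \<subseteq> snd \<omega> \<and> T \<subseteq> fst \<omega>))
        = (\<Sum>B\<in>layer V M. of_bool (T \<subseteq> B) * (\<Sum>A\<in>layer B m. of_bool (S \<subseteq> A)) :: real)"
      unfolding sum_nested[OF V] sum_distrib_left by (intro sum.cong refl) auto
    also have "\<dots> = (\<Sum>B\<in>layer V M. of_bool (T \<subseteq> B) * real ((M - card S) choose (M - m)))"
    proof (intro sum.cong refl)
      fix B assume B: "B \<in> layer V M"
      then have "finite B" "card B = M" using V finite_subset by (auto simp: layer_def)
      then show "of_bool (T \<subseteq> B) * (\<Sum>A\<in>layer B m. of_bool (S \<subseteq> A))
          = of_bool (T \<subseteq> B) * real ((M - card S) choose (M - m))"
        using sum_layer_supersets[of B S m] ST m by (cases "T \<subseteq> B") auto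
    qed
    also have "\<dots> = real ((?n - card T) choose (?n - M)) * real ((M - card S) choose (M - m))"
      using sum_layer_supersets[OF V ST(2) M] by (simp only: sum_distrib_right[symmetric])
    finally show "(\<Sum>\<omega>\<in>?P. of_bool (S \<subseteq> snd \<omega> \<and> T \<subseteq> fst \<omega>))
        = (\<lambda>s t. real ((?n - t) choose (?n - M)) * real ((M - s) choose (M - m))) (card S) (card T)" .
  qed (use P in blast)+
  have "(\<Sum>(B, A)\<in>?P. (?F B - ?F A)\<^sup>2)
      = (\<Sum>\<omega>\<in>?P. ?F (fst \<omega>) * ?F (fst \<omega>)) + (\<Sum>\<omega>\<in>?P. ?F (snd \<omega>) * ?F (snd \<omega>))
        - 2 * (\<Sum>\<omega>\<in>?P. ?F (snd \<omega>) * ?F (fst \<omega>))"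
    unfolding sum_distrib_left sum.distrib[symmetric] sum_subtractf[symmetric]
    by (intro sum.cong refl) (auto simp: power2_eq_square algebra_simps)
  also have "\<dots> = (\<Sum>S\<in>Pow V. (c S)\<^sup>2 * (\<Sum>\<omega>\<in>?P.
      of_bool (S \<subseteq> fst \<omega> \<and> U S \<inter> fst \<omega> = {}) + of_bool (S \<subseteq> snd \<omega> \<and> U S \<inter> snd \<omega> = {})
        - 2 * of_bool (S \<subseteq> snd \<omega> \<and> U S \<inter> fst \<omega> = {})))"
    unfolding AA BB AB
    by (simp only: sum.distrib sum_subtractf sum_distrib_left[symmetric] distrib_left
        right_diff_distrib mult.left_commute[of _ 2])
  also have "\<dots> \<le> (\<Sum>S\<in>Pow V. (c S)\<^sup>2 * (2 * real d * ?D))"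
  proof (intro sum_mono)
    fix S assume S: "S \<in> Pow V"
    show "(c S)\<^sup>2 * (\<Sum>\<omega>\<in>?P.
        of_bool (S \<subseteq> fst \<omega> \<and> U S \<inter> fst \<omega> = {}) + of_bool (S \<subseteq> snd \<omega> \<and> U S \<inter> snd \<omega> = {})
          - 2 * of_bool (S \<subseteq> snd \<omega> \<and> U S \<inter> fst \<omega> = {})) \<le> (c S)\<^sup>2 * (2 * real d * ?D)"
    proof (cases "c S = 0")
      case False
      then have cS: "card S \<le> d" and US: "U S \<subseteq> V - S" "card (U S) = card S"
        using S d U by auto
      have fin: "finite S" "finite (U S)" using S US V by (auto intro: finite_subset[of _ V])
      have "(\<Sum>\<omega>\<in>?P.
        of_bool (S \<subseteq> fst \<omega> \<and> U S \<inter> fst \<omega> = {}) + of_bool (S \<subseteq> snd \<omega> \<and> U S \<inter> snd \<omega> = {})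
          - 2 * of_bool (S \<subseteq> snd \<omega> \<and> U S \<inter> fst \<omega> = {}))
        \<le> (\<Sum>\<omega>\<in>?P. \<Sum>i\<in>S \<union> U S. of_bool (i \<in> fst \<omega> - snd \<omega>) :: real)"
      proof (intro sum_mono)
        fix \<omega> assume \<omega>: "\<omega> \<in> ?P"
        let ?L = "of_bool (S \<subseteq> fst \<omega> \<and> U S \<inter> fst \<omega> = {}) + of_bool (S \<subseteq> snd \<omega> \<and> U S \<inter> snd \<omega> = {})
          - 2 * of_bool (S \<subseteq> snd \<omega> \<and> U S \<inter> fst \<omega> = {}) :: real"
        let ?R = "\<Sum>i\<in>S \<union> U S. of_bool (i \<in> fst \<omega> - snd \<omega>) :: real"
        show "?L \<le> ?R"
        proof (cases "\<exists>i\<in>S \<union> U S. i \<in> fst \<omega> - snd \<omega>")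
          case True
          then obtain i where i: "i \<in> S \<union> U S" "i \<in> fst \<omega> - snd \<omega>" by blast
          \<comment> \<open>The left-hand side never exceeds \<open>1\<close>: if both added indicators are \<open>1\<close>, so is the subtracted one.\<close>
          have "1 \<le> ?R" using i fin member_le_sum[of i "S \<union> U S" "\<lambda>i. of_bool (i \<in> fst \<omega> - snd \<omega>) :: real"] by simp
          moreover have "?L \<le> 1" using P[OF \<omega>] by auto
          ultimately show ?thesis by linarith
        next
          case False
          then have "S \<subseteq> fst \<omega> \<longleftrightarrow> S \<subseteq> snd \<omega>" "U S \<inter> fst \<omega> = {} \<longleftrightarrow> U S \<inter> snd \<omega> = {}"
            using P[OF \<omega>] by blast+
          then have "?L = 0" by simp
          moreover have "0 \<le> ?R" by (intro sum_nonneg) simp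
          ultimately show ?thesis by linarith
        qed
      qed
      also have "\<dots> = (\<Sum>i\<in>S \<union> U S. \<Sum>(B, A)\<in>?P. of_bool (i \<in> B - A))"
        by (subst sum.swap) (simp add: case_prod_unfold)
      also have "\<dots> = (\<Sum>i\<in>S \<union> U S. ?D)"
        using S US sum_nested_differ_at[OF V _ m M] by (intro sum.cong refl) blast
      also have "\<dots> = 2 * real (card S) * ?D"
        using US fin by (subst sum_constant, subst card_Un_disjoint) auto
      also have "\<dots> \<le> 2 * real d * ?D"
        using cS D by (intro mult_right_mono) auto
      finally show ?thesis by (intro mult_left_mono) auto
    qed simp
  qed
  also have "\<dots> = 2 * real d * ((real M - real m) / real ?n) * (\<Sum>S\<in>Pow V. (c S)\<^sup>2) * real (card ?P)"
    by (simp only: sum_distrib_right[symmetric]) (simp add: mult_ac)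
  finally show ?thesis .
qed

section \<open>Means over different layers\<close>

definition layer_mean :: "'a set \<Rightarrow> nat \<Rightarrow> ('a set \<Rightarrow> real) \<Rightarrow> real" where
  "layer_mean V k h = (\<Sum>A\<in>layer V k. h A) / real (card (layer V k))"

lemma card_layer_pos: "finite V \<Longrightarrow> k \<le> card V \<Longrightarrow> 0 < card (layer V k)"
  by (simp add: card_layer)

text \<open>
  A Cauchy-Schwarz inequality in weighted form: it can be averaged termwise, and the weight \<open>t\<close> can
  be chosen at the very end.
\<close>

lemma abs_diff_squares_le:
  fixes u v a b t :: real
  assumes t: "t > 0" and uv: "\<bar>u - v\<bar> \<le> \<bar>a - b\<bar>"
  shows "\<bar>u\<^sup>2 - v\<^sup>2\<bar> \<le> t * u\<^sup>2 + (1 + 1 / t) * (a - b)\<^sup>2"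
proof -
  define e where "e = \<bar>a - b\<bar>"
  have e: "e \<ge> 0" "(a - b)\<^sup>2 = e\<^sup>2" by (auto simp: e_def)
  have "\<bar>u\<^sup>2 - v\<^sup>2\<bar> = \<bar>u - v\<bar> * \<bar>u + v\<bar>"
    by (simp add: abs_mult[symmetric] power2_eq_square algebra_simps)
  also have "\<dots> \<le> e * (2 * \<bar>u\<bar> + e)"
    using uv e by (intro mult_mono) (auto simp: e_def)
  also have "\<dots> \<le> t * u\<^sup>2 + (1 + 1 / t) * e\<^sup>2"
  proof -
    have "0 \<le> (t * \<bar>u\<bar> - e)\<^sup>2 / t" using t by simp
    also have "\<dots> = t * u\<^sup>2 - 2 * \<bar>u\<bar> * e + e\<^sup>2 / t"
      using t by (simp add: power2_diff power_mult_distrib field_simps power2_eq_square)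
    finally show ?thesis by (simp add: algebra_simps power2_eq_square)
  qed
  finally show ?thesis using e by simp
qed

text \<open>
  Both orders are needed, since the fixed layer, whose mean occurs on the right-hand side, can be
  the lower or the upper one.
\<close>

lemma nested_mean_difference:
  assumes V: "finite V" and h: "harmonic_on V c"
    and d: "\<And>S. S \<subseteq> V \<Longrightarrow> c S \<noteq> 0 \<Longrightarrow> card S \<le> d" and n: "2 * d \<le> card V"
    and m: "m \<le> M" and M: "M \<le> card V" and t: "t > 0"
    and \<psi>: "\<And>a b. \<bar>\<psi> a - \<psi> b\<bar> \<le> \<bar>a - b\<bar>"
  defines "f \<equiv> \<lambda>A. (\<psi> (subset_sum c A))\<^sup>2"
    and "E \<equiv> (1 + 1 / t) * (2 * real d * ((real M - real m) / real (card V)) * (\<Sum>S\<in>Pow V. (c S)\<^sup>2))"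
  shows "\<bar>layer_mean V m f - layer_mean V M f\<bar> \<le> t * layer_mean V m f + E"
    and "\<bar>layer_mean V M f - layer_mean V m f\<bar> \<le> t * layer_mean V M f + E"
proof -
  let ?P = "nested V m M" and ?F = "subset_sum c"
  let ?N = "real (card ?P)"
  have mn: "m \<le> card V" using m M by simp
  have N: "?N > 0" using V m M by (simp add: card_nested)
  have upper: "(\<Sum>\<omega>\<in>?P. g (fst \<omega>)) = ?N * layer_mean V M g" for g
    using card_layer_pos[OF V M] M
    by (simp add: sum_nested_upper[OF V] layer_mean_def card_nested[OF V] card_layer[OF V])
  have lower: "(\<Sum>\<omega>\<in>?P. g (snd \<omega>)) = ?N * layer_mean V m g" for g
  proof -
    have "?N = real ((card V - m) choose (card V - M)) * real (card (layer V m))"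
      using sum_nested_lower[OF V M, of "\<lambda>_. 1" m] by simp
    then show ?thesis
      using card_layer_pos[OF V mn] by (simp add: sum_nested_lower[OF V M] layer_mean_def)
  qed
  define K where "K = 1 + 1 / t"
  have diff: "K * (\<Sum>\<omega>\<in>?P. (?F (fst \<omega>) - ?F (snd \<omega>))\<^sup>2) \<le> ?N * E"
    using mult_left_mono[OF nested_difference_second_moment[OF V h d n m M], of K] t
    by (simp add: E_def K_def case_prod_unfold mult_ac)
  have lip: "\<bar>f A - f B\<bar> \<le> t * f A + K * (?F A - ?F B)\<^sup>2" for A B
    unfolding f_def K_def by (rule abs_diff_squares_le[OF t \<psi>])
  have "?N * \<bar>layer_mean V m f - layer_mean V M f\<bar> = \<bar>\<Sum>\<omega>\<in>?P. f (snd \<omega>) - f (fst \<omega>)\<bar>"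
    by (simp add: upper lower sum_subtractf abs_mult flip: right_diff_distrib)
  also have "\<dots> \<le> (\<Sum>\<omega>\<in>?P. t * f (snd \<omega>) + K * (?F (snd \<omega>) - ?F (fst \<omega>))\<^sup>2)"
    by (intro order_trans[OF sum_abs] sum_mono lip)
  also have "\<dots> \<le> ?N * (t * layer_mean V m f + E)"
    using diff by (simp only: sum.distrib lower sum_distrib_left[symmetric]
        power2_commute[of "?F (snd _)"] distrib_left mult.left_commute[of t])
  finally show "\<bar>layer_mean V m f - layer_mean V M f\<bar> \<le> t * layer_mean V m f + E"
    using N by simp
  have "?N * \<bar>layer_mean V M f - layer_mean V m f\<bar> = \<bar>\<Sum>\<omega>\<in>?P. f (fst \<omega>) - f (snd \<omega>)\<bar>"
    by (simp add: upper lower sum_subtractf abs_mult flip: right_diff_distrib)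
  also have "\<dots> \<le> (\<Sum>\<omega>\<in>?P. t * f (fst \<omega>) + K * (?F (fst \<omega>) - ?F (snd \<omega>))\<^sup>2)"
    by (intro order_trans[OF sum_abs] sum_mono lip)
  also have "\<dots> \<le> ?N * (t * layer_mean V M f + E)"
    using diff by (simp only: sum.distrib upper sum_distrib_left[symmetric]
        distrib_left mult.left_commute[of t])
  finally show "\<bar>layer_mean V M f - layer_mean V m f\<bar> \<le> t * layer_mean V M f + E"
    using N by simp
qed

lemma layer_mean_difference:
  assumes V: "finite V" and h: "harmonic_on V c"
    and d: "\<And>S. S \<subseteq> V \<Longrightarrow> c S \<noteq> 0 \<Longrightarrow> card S \<le> d" and n: "2 * d \<le> card V"
    and k: "k \<le> card V" and l: "l \<le> card V" and t: "t > 0"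
    and \<psi>: "\<And>a b. \<bar>\<psi> a - \<psi> b\<bar> \<le> \<bar>a - b\<bar>"
  defines "f \<equiv> \<lambda>A. (\<psi> (subset_sum c A))\<^sup>2"
  shows "\<bar>layer_mean V k f - layer_mean V l f\<bar> \<le> t * layer_mean V k f
    + (1 + 1 / t) * (2 * real d * (\<bar>real l - real k\<bar> / real (card V)) * (\<Sum>S\<in>Pow V. (c S)\<^sup>2))"
proof (cases "k \<le> l")
  case True
  show ?thesis
    using nested_mean_difference(1)[where \<psi> = \<psi>, OF V h d n True l t \<psi>] True
    by (simp add: f_def)
next
  case False
  then have "l \<le> k" by simp
  then show ?thesis
    using nested_mean_difference(2)[where \<psi> = \<psi>, OF V h d n _ k t \<psi>, of l]
    by (simp add: f_def abs_minus_commute)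
qed

section \<open>Averaging over the binomial distribution\<close>

lemma Bernstein_variance:
  "(\<Sum>l\<le>n. Bernstein n l p * (real l - real n * p)\<^sup>2) = real n * p * (1 - p)"
proof -
  have "(\<Sum>l\<le>n. Bernstein n l p * (real l - real n * p)\<^sup>2)
      = (\<Sum>l\<le>n. real l * (real l - 1) * Bernstein n l p
          + (1 - 2 * (real n * p)) * (real l * Bernstein n l p) + (real n * p)\<^sup>2 * Bernstein n l p)"
    by (intro sum.cong refl) (simp add: power2_eq_square algebra_simps)
  also have "\<dots> = real n * (real n - 1) * p\<^sup>2 + (1 - 2 * (real n * p)) * (real n * p) + (real n * p)\<^sup>2"
    by (simp add: sum.distrib flip: sum_distrib_left)
  also have "\<dots> = real n * p * (1 - p)"
    by (simp add: power2_eq_square algebra_simps)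
  finally show ?thesis .
qed

text \<open>
  By the inequality of the means, \<open>|x| \<le> x\<^sup>2 / (2 \<sigma>) + \<sigma> / 2\<close>; averaging uses only the variance \<open>\<sigma>\<^sup>2\<close>.
\<close>

lemma Bernstein_mean_abs_deviation:
  assumes p: "0 < p" "p < 1" and n: "n > 0"
  shows "(\<Sum>l\<le>n. Bernstein n l p * \<bar>real l - real n * p\<bar>) \<le> sqrt (p * (1 - p) * real n)"
proof -
  define \<sigma> where "\<sigma> = sqrt (p * (1 - p) * real n)"
  have \<sigma>: "\<sigma> > 0" "\<sigma>\<^sup>2 = p * (1 - p) * real n" using p n by (auto simp: \<sigma>_def)
  have "\<bar>x\<bar> \<le> (1 / (2 * \<sigma>)) * x\<^sup>2 + \<sigma> / 2" for x
  proof -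
    have "0 \<le> (\<bar>x\<bar> - \<sigma>)\<^sup>2 / (2 * \<sigma>)" using \<sigma> by simp
    also have "\<dots> = (1 / (2 * \<sigma>)) * x\<^sup>2 + \<sigma> / 2 - \<bar>x\<bar>"
      using \<sigma>(1) by (simp add: power2_diff field_simps power2_eq_square)
    finally show ?thesis by simp
  qed
  then have "(\<Sum>l\<le>n. Bernstein n l p * \<bar>real l - real n * p\<bar>)
      \<le> (\<Sum>l\<le>n. Bernstein n l p * ((1 / (2 * \<sigma>)) * (real l - real n * p)\<^sup>2 + \<sigma> / 2))"
    using p by (intro sum_mono mult_left_mono Bernstein_nonneg) auto
  also have "\<dots> = (1 / (2 * \<sigma>)) * (\<Sum>l\<le>n. Bernstein n l p * (real l - real n * p)\<^sup>2)
      + \<sigma> / 2 * (\<Sum>l\<le>n. Bernstein n l p)"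
    unfolding sum_distrib_left sum.distrib[symmetric]
    by (intro sum.cong refl) (simp only: distrib_left mult_ac)
  also have "\<dots> = (1 / (2 * \<sigma>)) * \<sigma>\<^sup>2 + \<sigma> / 2"
    by (simp only: Bernstein_variance sum_Bernstein \<sigma>(2)) (simp add: mult_ac)
  also have "\<dots> = \<sigma>"
    using \<sigma>(1) by (simp add: power2_eq_square)
  finally show ?thesis by (simp add: \<sigma>_def)
qed

text \<open>
  The comparison of layers \<open>k\<close> and \<open>l\<close> is linear in \<open>|l - k|\<close>, so its binomial average only involves
  the mean deviation, which is at most the standard deviation \<open>\<sigma>\<close>.
\<close>

lemma binomial_mixture_difference:
  assumes V: "finite V" and n: "card V = n" "n > 0" and p: "0 < p" "p < 1" and k: "p * real n = real k"
    and h: "harmonic_on V c"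
    and d: "\<And>S. S \<subseteq> V \<Longrightarrow> c S \<noteq> 0 \<Longrightarrow> card S \<le> d" and dn: "2 * d \<le> n"
    and t: "t > 0" and \<psi>: "\<And>a b. \<bar>\<psi> a - \<psi> b\<bar> \<le> \<bar>a - b\<bar>"
  defines "f \<equiv> \<lambda>A. (\<psi> (subset_sum c A))\<^sup>2" and "\<sigma> \<equiv> sqrt (p * (1 - p) * real n)"
  shows "\<bar>layer_mean V k f - (\<Sum>l\<le>n. Bernstein n l p * layer_mean V l f)\<bar>
    \<le> t * layer_mean V k f + (1 + 1 / t) * (2 * real d * (\<sigma> / real n) * (\<Sum>S\<in>Pow V. (c S)\<^sup>2))"
proof -
  let ?B = "\<lambda>l. Bernstein n l p" and ?Q = "\<Sum>S\<in>Pow V. (c S)\<^sup>2"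
  define D where "D = (1 + 1 / t) * (2 * real d / real n * ?Q)"
  have D: "D \<ge> 0" using t unfolding D_def by (intro mult_nonneg_nonneg sum_nonneg) auto
  have "real k \<le> real n" using k p by (metis mult_left_le_one_le less_imp_le of_nat_0_le_iff)
  then have kn: "k \<le> card V" using n by simp
  have B: "?B l \<ge> 0" for l using p by (intro Bernstein_nonneg) auto
  have "layer_mean V k f - (\<Sum>l\<le>n. ?B l * layer_mean V l f)
      = (\<Sum>l\<le>n. ?B l * (layer_mean V k f - layer_mean V l f))"
    by (simp add: right_diff_distrib sum_subtractf flip: sum_distrib_right)
  also have "\<bar>\<dots>\<bar> \<le> (\<Sum>l\<le>n. ?B l * (t * layer_mean V k f + D * \<bar>real l - real n * p\<bar>))"
  proof (intro order_trans[OF sum_abs] sum_mono)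
    fix l assume "l \<in> {..n}"
    then have "l \<le> card V" using n by simp
    from layer_mean_difference[where \<psi> = \<psi>, OF V h d _ kn this t \<psi>] dn n k
    have "\<bar>layer_mean V k f - layer_mean V l f\<bar> \<le> t * layer_mean V k f + D * \<bar>real l - real n * p\<bar>"
      by (simp add: f_def D_def mult_ac)
    then show "\<bar>?B l * (layer_mean V k f - layer_mean V l f)\<bar>
        \<le> ?B l * (t * layer_mean V k f + D * \<bar>real l - real n * p\<bar>)"
      using B[of l] by (simp add: abs_mult mult_left_mono)
  qed
  also have "\<dots> = t * layer_mean V k f * (\<Sum>l\<le>n. ?B l) + D * (\<Sum>l\<le>n. ?B l * \<bar>real l - real n * p\<bar>)"
    unfolding sum_distrib_left sum.distrib[symmetric]
    by (intro sum.cong refl) (simp only: distrib_left mult_ac)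
  also have "\<dots> \<le> t * layer_mean V k f + D * \<sigma>"
    using Bernstein_mean_abs_deviation[OF p n(2)] D by (simp add: \<sigma>_def mult_left_mono)
  finally show ?thesis by (simp add: D_def mult_ac)
qed

lemma coefficient_mass_bound:
  assumes V: "finite V" and n: "card V = n" "n > 0" and p: "0 < p" "p < 1" and k: "p * real n = real k"
    and h: "harmonic_on V c"
    and d: "\<And>S. S \<subseteq> V \<Longrightarrow> c S \<noteq> 0 \<Longrightarrow> card S \<le> d"
    and dk: "2 * d \<le> k" "2 * d + k \<le> n"
    and norm: "layer_mean V k (\<lambda>A. (subset_sum c A)\<^sup>2) = 1"
  shows "(\<Sum>S\<in>Pow V. (c S)\<^sup>2) \<le> (4 / (p * (1 - p))) ^ d"
proof -
  let ?Q = "\<Sum>S\<in>Pow V. (c S)\<^sup>2"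
  have pq: "0 < p * (1 - p)" "p * (1 - p) \<le> 1" using p by (auto intro: mult_le_one)
  have r: "real k * (real n - real k) / (4 * (real n)\<^sup>2) = p * (1 - p) / 4"
    using n(2) unfolding k[symmetric] by (simp add: field_simps power2_eq_square)
  have c: "real (card (layer V k)) > 0"
    using card_layer_pos[OF V, of k] dk n by simp
  have "(p * (1 - p) / 4) ^ d * ?Q * real (card (layer V k)) \<le> (\<Sum>A\<in>layer V k. (subset_sum c A)\<^sup>2)"
    using layer_second_moment[OF V h d dk(1)] dk n r pq by simp
  also have "\<dots> = real (card (layer V k))"
    using norm c by (simp add: layer_mean_def)
  finally have "(p * (1 - p) / 4) ^ d * ?Q \<le> 1" using c by simp
  then have "?Q \<le> 1 / (p * (1 - p) / 4) ^ d"
    using pq by (subst pos_le_divide_eq) (auto simp: mult.commute)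
  also have "\<dots> = (4 / (p * (1 - p))) ^ d" by (simp add: power_divide)
  finally show ?thesis .
qed

text \<open>
  With \<open>\<epsilon> = d / \<sigma>\<close>, the previous bounds leave an error of at most \<open>2 t + (1 + 1 / t) \<epsilon> C\<close>, where \<open>C\<close> is
  exponential in \<open>d\<close>. The choice \<open>t = \<surd>\<epsilon>\<close> gives the order \<open>\<surd>\<epsilon>\<close>, which is at most \<open>\<epsilon>\<close> to the power \<open>1/4\<close>
  as \<open>\<epsilon> \<le> 1\<close>.
  For \<open>d = 0\<close> the second term vanishes and \<open>t\<close> tends to \<open>0\<close> instead.
\<close>

lemma set_invariance:
  assumes V: "finite V" and n: "card V = n" "n > 0" and p: "0 < p" "p < 1" and k: "p * real n = real k"
    and h: "harmonic_on V c"
    and d: "\<And>S. S \<subseteq> V \<Longrightarrow> c S \<noteq> 0 \<Longrightarrow> card S \<le> d"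
    and d\<sigma>: "real d \<le> 1 / 2 * sqrt (p * (1 - p) * real n)"
    and norm: "layer_mean V k (\<lambda>A. (subset_sum c A)\<^sup>2) = 1"
  defines "f \<equiv> \<lambda>A. (\<bar>subset_sum c A\<bar> - 1)\<^sup>2" and "\<sigma> \<equiv> sqrt (p * (1 - p) * real n)"
  shows "\<bar>layer_mean V k f - (\<Sum>l\<le>n. Bernstein n l p * layer_mean V l f)\<bar>
    \<le> 3 * (real d / \<sigma>) powr (1/4) * (p * (1 - p)) powr (- 3 * real d)"
proof -
  define w where "w = p * (1 - p)"
  define Q where "Q = (\<Sum>S\<in>Pow V. (c S)\<^sup>2)"
  define R where "R = \<bar>layer_mean V k f - (\<Sum>l\<le>n. Bernstein n l p * layer_mean V l f)\<bar>"
  have w: "0 < w" "w \<le> 1 / 4"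
  proof -
    have "1 / 4 - w = (p - 1 / 2)\<^sup>2" by (simp add: w_def power2_eq_square algebra_simps)
    then show "w \<le> 1 / 4" by (metis diff_ge_0_iff_ge zero_le_power2)
  qed (use p in \<open>simp add: w_def\<close>)
  have \<sigma>: "\<sigma> > 0" "\<sigma>\<^sup>2 = w * real n" using w n by (auto simp: \<sigma>_def w_def[symmetric])
  have kn: "0 < k" "k < n" "real n - real k = (1 - p) * real n"
  proof -
    have "0 < real k" "real k < real n" using p n unfolding k[symmetric] by auto
    then show "0 < k" "k < n" by auto
    show "real n - real k = (1 - p) * real n" by (simp add: algebra_simps flip: k)
  qed
  have "(2 * real d)\<^sup>2 \<le> \<sigma>\<^sup>2" using d\<sigma> by (intro power_mono) (auto simp: \<sigma>_def)
  then have d2: "(2 * real d)\<^sup>2 \<le> w * real n" by (simp add: \<sigma>)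
  \<comment> \<open>For positive integers \<open>j \<le> j\<^sup>2\<close>, so a bound on \<open>(2 d)\<^sup>2\<close> by \<open>j\<close> gives \<open>2 d \<le> j\<close>.\<close>
  have sq: "2 * d \<le> j" if "w * real n \<le> real j" "0 < j" for j :: nat
  proof -
    have "real j \<le> (real j)\<^sup>2" using that(2) by (simp add: power2_eq_square)
    then have "(2 * real d)\<^sup>2 \<le> (real j)\<^sup>2" using d2 that(1) by linarith
    then have "2 * real d \<le> real j" by (rule power2_le_imp_le) simp
    then show ?thesis by linarith
  qed
  have "w * real n \<le> p * real n" "w * real n \<le> (1 - p) * real n"
    using p by (auto simp: w_def intro!: mult_right_mono mult_left_le mult_left_le_one_le)
  then have dk: "2 * d \<le> k" "2 * d \<le> n - k"
    using sq[of k] sq[of "n - k"] k kn by (auto simp: of_nat_diff)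
  have Q: "Q \<le> (4 / w) ^ d" "Q \<ge> 0"
    using coefficient_mass_bound[OF V n p k h d dk(1) _ norm] dk kn
    by (auto simp: Q_def w_def intro: sum_nonneg)
  have f2: "layer_mean V k f \<le> 2"
  proof -
    have pos: "real (card (layer V k)) > 0" using card_layer_pos[OF V] kn n by simp
    have "(\<Sum>A\<in>layer V k. f A) \<le> (\<Sum>A\<in>layer V k. (subset_sum c A)\<^sup>2 + 1)"
      unfolding f_def by (intro sum_mono) (simp add: power2_diff)
    also have "\<dots> = 2 * real (card (layer V k))"
      using norm pos by (simp add: sum.distrib layer_mean_def)
    finally show ?thesis using pos by (simp add: layer_mean_def pos_divide_le_eq)
  qed
  have key: "R \<le> t * 2 + (1 + 1 / t) * (2 * real d * (\<sigma> / real n) * Q)" if t: "t > 0" for t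
  proof -
    have "R \<le> t * layer_mean V k f + (1 + 1 / t) * (2 * real d * (\<sigma> / real n) * Q)"
      using binomial_mixture_difference[where \<psi> = "\<lambda>x. \<bar>x\<bar> - 1" and d = d, OF V n p k h d _ t] dk kn
      by (simp add: R_def f_def \<sigma>_def Q_def)
    also have "t * layer_mean V k f \<le> t * 2" using f2 t by simp
    finally show ?thesis by simp
  qed
  show ?thesis
  proof (cases "d = 0")
    case True
    have "R \<le> 0 + e" if "e > 0" for e
      using key[of "e / 2"] that True by simp
    then have "R \<le> 0" by (rule field_le_epsilon)
    then show ?thesis using True by (simp add: R_def)
  next
    case False
    define \<epsilon> where "\<epsilon> = real d / \<sigma>"
    define s where "s = sqrt \<epsilon>"
    have \<epsilon>: "0 < \<epsilon>" "\<epsilon> \<le> 1" using False \<sigma> d\<sigma> by (auto simp: \<epsilon>_def \<sigma>_def[symmetric] divide_simps)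
    have s: "0 < s" "s \<le> 1" "s\<^sup>2 = \<epsilon>" using \<epsilon> by (auto simp: s_def)
    define X where "X = w powr (- 3 * real d)"
    have wX: "w * (4 / w) ^ d \<le> X / 4"
    proof -
      \<comment> \<open>\<open>4 \<le> 1 / w\<close>, which absorbs the constant into another power of \<open>w\<close>.\<close>
      have "(4 / w) ^ d \<le> (1 / w ^ 2) ^ d"
        using w by (intro power_mono) (auto simp: field_simps power2_eq_square)
      also have "\<dots> = w powr (- 2 * real d)"
      proof -
        have "w powr (- 2 * real d) = 1 / w powr real (2 * d)"
          by (simp add: powr_minus inverse_eq_divide)
        also have "\<dots> = 1 / w ^ (2 * d)" by (simp only: powr_realpow[OF w(1)])
        finally show ?thesis by (simp only: power_mult power_one_over)
      qed
      also have "\<dots> \<le> X"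
        unfolding X_def using w by (intro powr_mono') auto
      finally have "w * (4 / w) ^ d \<le> 1 / 4 * X"
        using w by (intro mult_mono) auto
      then show ?thesis by simp
    qed
    have X: "X \<ge> 1"
      unfolding X_def using w powr_mono'[of "- 3 * real d" 0 w] by simp
    have "2 * real d * (\<sigma> / real n) = 2 * (\<epsilon> * w)"
    proof -
      have "\<sigma> / real n = w / \<sigma>" using \<sigma> n by (simp add: field_simps power2_eq_square)
      then show ?thesis by (simp add: \<epsilon>_def)
    qed
    then have "R \<le> s * 2 + (1 + 1 / s) * (2 * (\<epsilon> * w) * Q)"
      using key[OF s(1)] by (simp only:)
    also have "(1 + 1 / s) * (2 * (\<epsilon> * w) * Q) = (s + 1) * s * (2 * (w * Q))"
      using s(1) unfolding s(3)[symmetric] by (simp add: field_simps power2_eq_square)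
    also have "\<dots> \<le> 2 * s * (2 * (X / 4))"
    proof -
      have "w * Q \<le> w * (4 / w) ^ d" using Q w by (intro mult_left_mono) auto
      then have "w * Q \<le> X / 4" using wX by linarith
      then show ?thesis using s Q w by (intro mult_mono) auto
    qed
    also have "s * 2 + 2 * s * (2 * (X / 4)) \<le> 3 * s * X"
    proof -
      have "s * 1 \<le> s * X" using s X by (intro mult_left_mono) auto
      then show ?thesis by (simp add: mult_ac)
    qed
    also have "\<dots> \<le> 3 * \<epsilon> powr (1/4) * X"
    proof -
      have "s = \<epsilon> powr (1/2)" using \<epsilon> by (simp add: s_def powr_half_sqrt)
      also have "\<dots> \<le> \<epsilon> powr (1/4)" using \<epsilon> by (intro powr_mono') auto
      finally show ?thesis using X by (intro mult_right_mono) auto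
    qed
    finally show ?thesis by (simp add: R_def \<epsilon>_def X_def w_def)
  qed
qed

section \<open>Multilinear polynomials and measures on the cube\<close>

definition squarefree_monomial :: "nat set \<Rightarrow> monomial" where
  "squarefree_monomial S = (\<Sum>i\<in>S. Poly_Mapping.single i 1)"

lemma lookup_squarefree_monomial:
  "finite S \<Longrightarrow> Poly_Mapping.lookup (squarefree_monomial S) i = of_bool (i \<in> S)"
  by (simp add: squarefree_monomial_def lookup_sum lookup_single when_def)

lemma keys_squarefree_monomial: "finite S \<Longrightarrow> Poly_Mapping.keys (squarefree_monomial S) = S"
  by (auto simp: in_keys_iff lookup_squarefree_monomial)

lemma squarefree_monomial_inj:
  "finite S \<Longrightarrow> finite T \<Longrightarrow> squarefree_monomial S = squarefree_monomial T \<longleftrightarrow> S = T"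
  by (metis keys_squarefree_monomial)

lemma squarefree_monomial_minus:
  assumes "finite S" "i \<in> S"
  shows "squarefree_monomial S - Poly_Mapping.single i 1 = squarefree_monomial (S - {i})"
  using assms
  by (intro poly_mapping_eqI) (auto simp: lookup_minus lookup_squarefree_monomial lookup_single when_def)

lemma sum_multilinear_monomials:
  assumes "poly_in_vars n f" "multilinear_poly f"
    and "\<And>m. m \<notin> Poly_Mapping.keys f \<Longrightarrow> g m = (0 :: real)"
  shows "(\<Sum>m\<in>Poly_Mapping.keys f. g m) = (\<Sum>S\<in>Pow {1..n}. g (squarefree_monomial S))"
proof -
  have fin: "finite S" if "S \<in> Pow {1..n}" for S using that finite_subset by auto
  have "m \<in> squarefree_monomial ` Pow {1..n}" if m: "m \<in> Poly_Mapping.keys f" for m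
  proof (rule image_eqI)
    show "m = squarefree_monomial (Poly_Mapping.keys m)"
    proof (rule poly_mapping_eqI)
      fix i
      have "Poly_Mapping.lookup m i \<le> 1" using assms(2) m by (auto simp: multilinear_poly_def)
      then show "Poly_Mapping.lookup m i
          = Poly_Mapping.lookup (squarefree_monomial (Poly_Mapping.keys m)) i"
        by (auto simp: lookup_squarefree_monomial in_keys_iff)
    qed
    show "Poly_Mapping.keys m \<in> Pow {1..n}" using assms(1) m by (auto simp: poly_in_vars_def)
  qed
  then have "(\<Sum>m\<in>Poly_Mapping.keys f. g m) = (\<Sum>m\<in>squarefree_monomial ` Pow {1..n}. g m)"
    using assms(3) by (intro sum.mono_neutral_left) auto
  also have "\<dots> = (\<Sum>S\<in>Pow {1..n}. g (squarefree_monomial S))"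
    using fin by (subst sum.reindex) (auto simp: inj_on_def squarefree_monomial_inj)
  finally show ?thesis .
qed

definition set_coeff :: "real_mpoly \<Rightarrow> nat set \<Rightarrow> real" where
  "set_coeff f S = Poly_Mapping.lookup f (squarefree_monomial S)"

definition indicator_point :: "nat set \<Rightarrow> nat \<Rightarrow> real" where
  "indicator_point A = (\<lambda>i. of_bool (i \<in> A))"

lemma poly_eval_indicator_point:
  assumes "poly_in_vars n f" "multilinear_poly f" and A: "A \<subseteq> {1..n}"
  shows "poly_eval f (indicator_point A) = subset_sum (set_coeff f) A"
proof -
  have "poly_eval f (indicator_point A) = (\<Sum>S\<in>Pow {1..n}. set_coeff f S *
      (\<Prod>i\<in>Poly_Mapping.keys (squarefree_monomial S).
        indicator_point A i ^ Poly_Mapping.lookup (squarefree_monomial S) i))"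
    unfolding poly_eval_def set_coeff_def
    by (rule sum_multilinear_monomials[OF assms(1,2)]) (simp add: in_keys_iff)
  also have "\<dots> = (\<Sum>S\<in>Pow {1..n}. set_coeff f S * of_bool (S \<subseteq> A))"
  proof (intro sum.cong refl arg_cong[where f = "(*) _"])
    fix S assume "S \<in> Pow {1..n}"
    then have fin: "finite S" using finite_subset by auto
    have "(\<Prod>i\<in>Poly_Mapping.keys (squarefree_monomial S).
        indicator_point A i ^ Poly_Mapping.lookup (squarefree_monomial S) i)
        = (\<Prod>i\<in>S. of_bool (i \<in> A) :: real)"
      using fin by (simp add: keys_squarefree_monomial lookup_squarefree_monomial indicator_point_def)
    also have "\<dots> = of_bool (S \<subseteq> A)"
      using fin by (auto simp: subset_iff intro!: prod.neutral)
    finally show "(\<Prod>i\<in>Poly_Mapping.keys (squarefree_monomial S).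
        indicator_point A i ^ Poly_Mapping.lookup (squarefree_monomial S) i) = of_bool (S \<subseteq> A)" .
  qed
  finally show ?thesis by (simp only: subset_sum_indicator[OF finite_atLeastAtMost A])
qed

text \<open>
  Coefficients are compared at the monomial of \<open>T\<close>: the derivative in \<open>x\<^sub>i\<close> produces it only from the
  monomial of \<open>T \<union> {i}\<close>, and only if \<open>i \<notin> T\<close>.
\<close>

lemma harmonic_on_set_coeff:
  assumes f: "poly_in_vars n f" "multilinear_poly f" and h: "harmonic_poly n f"
  shows "harmonic_on {1..n} (set_coeff f)"
  unfolding harmonic_on_def
proof (intro allI impI)
  fix T assume T: "T \<subseteq> {1..n}"
  then have fT: "finite T" using finite_subset by auto
  have deriv: "Poly_Mapping.lookup (partial_deriv i f) (squarefree_monomial T)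
      = (if i \<in> T then 0 else set_coeff f (insert i T))" if i: "i \<in> {1..n}" for i
  proof -
    have "Poly_Mapping.lookup (partial_deriv i f) (squarefree_monomial T)
        = (\<Sum>m\<in>Poly_Mapping.keys f. real (Poly_Mapping.lookup m i) * Poly_Mapping.lookup f m
            when m - Poly_Mapping.single i 1 = squarefree_monomial T)"
      by (simp add: partial_deriv_def lookup_sum lookup_single)
    also have "\<dots> = (\<Sum>S\<in>Pow {1..n}.
        real (Poly_Mapping.lookup (squarefree_monomial S) i) * Poly_Mapping.lookup f (squarefree_monomial S)
            when squarefree_monomial S - Poly_Mapping.single i 1 = squarefree_monomial T)"
      by (rule sum_multilinear_monomials[OF f]) (simp add: in_keys_iff)
    also have "\<dots> = (\<Sum>S\<in>Pow {1..n}. if S = insert i T then (if i \<in> T then 0 else set_coeff f S) else 0)"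
    proof (intro sum.cong refl)
      fix S assume "S \<in> Pow {1..n}"
      then have fS: "finite S" using finite_subset by auto
      show "(real (Poly_Mapping.lookup (squarefree_monomial S) i) * Poly_Mapping.lookup f (squarefree_monomial S)
            when squarefree_monomial S - Poly_Mapping.single i 1 = squarefree_monomial T)
          = (if S = insert i T then (if i \<in> T then 0 else set_coeff f S) else 0)"
      proof (cases "i \<in> S")
        case True
        then have "squarefree_monomial S - Poly_Mapping.single i 1 = squarefree_monomial T \<longleftrightarrow> S - {i} = T"
          using fS fT by (subst squarefree_monomial_minus) (simp_all add: squarefree_monomial_inj)
        also have "\<dots> \<longleftrightarrow> S = insert i T \<and> i \<notin> T" using True by auto
        finally show ?thesis
          using True fS by (auto simp: when_def lookup_squarefree_monomial set_coeff_def)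
      next
        case False
        then show ?thesis using fS by (auto simp: lookup_squarefree_monomial)
      qed
    qed
    also have "\<dots> = (if i \<in> T then 0 else set_coeff f (insert i T))"
      using T i by (simp add: sum.delta)
    finally show ?thesis .
  qed
  have "0 = Poly_Mapping.lookup (\<Sum>i=1..n. partial_deriv i f) (squarefree_monomial T)"
    using h by (simp add: harmonic_poly_def)
  also have "\<dots> = (\<Sum>i\<in>{1..n}. if i \<in> T then 0 else set_coeff f (insert i T))"
    unfolding lookup_sum by (intro sum.cong refl deriv)
  also have "\<dots> = (\<Sum>i\<in>{1..n} - T. set_coeff f (insert i T))"
    by (intro sum.mono_neutral_cong_right) auto
  finally show "(\<Sum>i\<in>{1..n} - T. set_coeff f (insert i T)) = 0" by simp
qed

lemma card_le_total_degree:
  assumes "finite S" "set_coeff f S \<noteq> 0"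
  shows "card S \<le> total_degree f"
proof -
  let ?deg = "\<lambda>m. \<Sum>i\<in>Poly_Mapping.keys m. Poly_Mapping.lookup m i"
  have "squarefree_monomial S \<in> Poly_Mapping.keys f"
    using assms by (simp add: set_coeff_def in_keys_iff)
  then have "?deg (squarefree_monomial S) \<le> total_degree f"
    unfolding total_degree_def by (intro Max_ge) auto
  then show ?thesis
    using assms by (simp add: keys_squarefree_monomial lookup_squarefree_monomial)
qed

lemma inj_indicator_point: "inj indicator_point"
  by (auto simp: inj_def indicator_point_def fun_eq_iff)

lemma sum_indicator_point: "A \<subseteq> {1..n} \<Longrightarrow> (\<Sum>i=1..n. indicator_point A i) = real (card A)"
  by (simp add: indicator_point_def Int_absorb1)

lemma indicator_point_in_cube: "A \<subseteq> {1..n} \<Longrightarrow> indicator_point A \<in> cube n"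
  by (auto simp: cube_def PiE_dflt_def indicator_point_def)

lemma cube_eq: "cube n = indicator_point ` Pow {1..n}"
proof -
  have "x \<in> indicator_point ` Pow {1..n}" if x: "x \<in> cube n" for x
  proof (rule image_eqI)
    show "x = indicator_point {i \<in> {1..n}. x i = 1}"
    proof
      fix i show "x i = indicator_point {i \<in> {1..n}. x i = 1} i"
        using x unfolding cube_def PiE_dflt_def indicator_point_def by (cases "i \<in> {1..n}") auto
    qed
  qed auto
  then show ?thesis using indicator_point_in_cube by auto
qed

lemma slice_eq: "slice n k = indicator_point ` layer {1..n} k"
  unfolding slice_def cube_eq by (auto simp: layer_def sum_indicator_point simp del: One_nat_def)

lemma expectation_nu:
  assumes "k \<le> n"
  shows "measure_pmf.expectation (nu n k) g = layer_mean {1..n} k (\<lambda>A. g (indicator_point A))"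
proof -
  have inj: "inj_on indicator_point X" for X
    using inj_indicator_point by (rule inj_on_subset) simp
  show ?thesis
    unfolding nu_def integral_pmf_of_set[OF slice_nonempty[OF assms] finite_slice]
    by (simp add: slice_eq layer_mean_def sum.reindex[OF inj] card_image[OF inj])
qed

text \<open>
  The product measure gives all sets of one size the same weight, so it is the binomial mixture of
  the uniform measures on the layers.
\<close>

lemma expectation_mu:
  assumes p: "0 < p" "p < 1"
  shows "measure_pmf.expectation (mu n p) g
    = (\<Sum>l\<le>n. Bernstein n l p * layer_mean {1..n} l (\<lambda>A. g (indicator_point A)))"
proof -
  have inj: "inj_on indicator_point X" for X
    using inj_indicator_point by (rule inj_on_subset) simp
  have supp: "set_pmf (mu n p) \<subseteq> cube n"
  proof -
    have "set_pmf (map_pmf of_bool (bernoulli_pmf p)) \<subseteq> {0, 1 :: real}" by auto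
    moreover have "set_pmf (mu n p) = PiE_dflt {1..n} 0 (\<lambda>_. set_pmf (map_pmf of_bool (bernoulli_pmf p)))"
      unfolding mu_def by (subst set_Pi_pmf) (simp_all only: o_def finite_atLeastAtMost)
    ultimately show ?thesis unfolding cube_def PiE_dflt_def by blast
  qed
  have pmf: "pmf (mu n p) (indicator_point A) = p ^ l * (1 - p) ^ (n - l)"
    if A: "A \<in> layer {1..n} l" for A l
  proof -
    have A': "A \<subseteq> {1..n}" "card A = l" using A by (auto simp: layer_def)
    then have "l \<le> n" using card_mono[of "{1..n}" A] by simp
    then have "(\<Sum>i=1..n. 1 - indicator_point A i) = real (n - l)"
      using A' by (simp only: sum_subtractf sum_indicator_point) (simp add: of_nat_diff)
    then show ?thesis
      using A' p by (simp only: pmf_mu[OF p indicator_point_in_cube] sum_indicator_point) (simp add: powr_realpow)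
  qed
  have "measure_pmf.expectation (mu n p) g = (\<Sum>x\<in>cube n. g x * pmf (mu n p) x)"
    using supp by (intro integral_measure_pmf_real finite_cube) auto
  also have "\<dots> = (\<Sum>A\<in>Pow {1..n}. g (indicator_point A) * pmf (mu n p) (indicator_point A))"
    by (simp only: cube_eq sum.reindex[OF inj] o_def)
  also have "\<dots> = (\<Sum>l\<le>n. \<Sum>A\<in>layer {1..n} l. g (indicator_point A) * pmf (mu n p) (indicator_point A))"
    by (subst sum_Pow_layers) auto
  also have "\<dots> = (\<Sum>l\<le>n. \<Sum>A\<in>layer {1..n} l. g (indicator_point A) * (p ^ l * (1 - p) ^ (n - l)))"
    by (intro sum.cong refl) (simp only: pmf)
  also have "\<dots> = (\<Sum>l\<le>n. Bernstein n l p * layer_mean {1..n} l (\<lambda>A. g (indicator_point A)))"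
    unfolding sum_distrib_right[symmetric] layer_mean_def Bernstein_def
    by (intro sum.cong refl) (simp add: card_layer)
  finally show ?thesis .
qed

theorem theorem5p3:
  "\<exists>K C :: real. K > 0 \<and> C > 0 \<and>
    (\<forall>(n::nat) (p::real) (k::nat) (f::real_mpoly) (d::nat).
       n \<ge> 1 \<longrightarrow> 0 < p \<longrightarrow> p < 1 \<longrightarrow> p * real n = real k \<longrightarrow>
       p * (1 - p) * real n \<ge> 3 * ln (real n) \<longrightarrow>
       poly_in_vars n f \<longrightarrow> multilinear_poly f \<longrightarrow> harmonic_poly n f \<longrightarrow>
       total_degree f = d \<longrightarrow>
       real d \<le> K * sqrt (p * (1 - p) * real n) \<longrightarrow>
       norm_pmf (nu n k) (poly_eval f) = 1 \<longrightarrow>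
       \<bar>measure_pmf.expectation (nu n k) (\<lambda>x. (\<bar>poly_eval f x\<bar> - 1)\<^sup>2)
         - measure_pmf.expectation (mu n p) (\<lambda>x. (\<bar>poly_eval f x\<bar> - 1)\<^sup>2)\<bar>
       \<le> C * (real d / sqrt (p * (1 - p) * real n)) powr (1/4)
           * (p * (1 - p)) powr (- C * real d))"
proof (rule exI[of _ "1 / 2"], rule exI[of _ 3], intro conjI allI impI)
  fix n k d :: nat and p :: real and f :: real_mpoly
  assume n: "n \<ge> 1" and p: "0 < p" "p < 1" and k: "p * real n = real k"
    and f: "poly_in_vars n f" "multilinear_poly f" and h: "harmonic_poly n f"
    and d: "total_degree f = d" "real d \<le> 1 / 2 * sqrt (p * (1 - p) * real n)"
    and norm: "norm_pmf (nu n k) (poly_eval f) = 1"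
  let ?V = "{1..n}" and ?F = "subset_sum (set_coeff f)"
  have "real k \<le> real n" using k p by (metis mult_left_le_one_le less_imp_le of_nat_0_le_iff)
  then have kn: "k \<le> n" by simp
  have eval: "layer_mean ?V l (\<lambda>A. \<phi> (poly_eval f (indicator_point A))) = layer_mean ?V l (\<lambda>A. \<phi> (?F A))"
    for l \<phi>
    unfolding layer_mean_def using f
    by (intro arg_cong2[where f = "(/)"] sum.cong refl) (auto simp: layer_def poly_eval_indicator_point)
  have "measure_pmf.expectation (nu n k) (\<lambda>x. (poly_eval f x)\<^sup>2) = 1"
    using norm by (simp add: norm_pmf_def real_sqrt_eq_1_iff)
  then have norm': "layer_mean ?V k (\<lambda>A. (?F A)\<^sup>2) = 1"
    using eval[of k "\<lambda>x. x\<^sup>2"] by (simp add: expectation_nu[OF kn])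
  have deg: "card S \<le> d" if "S \<subseteq> ?V" "set_coeff f S \<noteq> 0" for S
    using that card_le_total_degree[of S f] d(1) finite_subset by auto
  have "\<bar>layer_mean ?V k (\<lambda>A. (\<bar>?F A\<bar> - 1)\<^sup>2)
      - (\<Sum>l\<le>n. Bernstein n l p * layer_mean ?V l (\<lambda>A. (\<bar>?F A\<bar> - 1)\<^sup>2))\<bar>
      \<le> 3 * (real d / sqrt (p * (1 - p) * real n)) powr (1/4) * (p * (1 - p)) powr (- 3 * real d)"
    using n by (intro set_invariance[OF _ _ _ p k harmonic_on_set_coeff[OF f h] deg d(2) norm']) auto
  then show "\<bar>measure_pmf.expectation (nu n k) (\<lambda>x. (\<bar>poly_eval f x\<bar> - 1)\<^sup>2)
       - measure_pmf.expectation (mu n p) (\<lambda>x. (\<bar>poly_eval f x\<bar> - 1)\<^sup>2)\<bar>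
      \<le> 3 * (real d / sqrt (p * (1 - p) * real n)) powr (1/4) * (p * (1 - p)) powr (- 3 * real d)"
    using eval[of _ "\<lambda>x. (\<bar>x\<bar> - 1)\<^sup>2"] by (simp only: expectation_nu[OF kn] expectation_mu[OF p])
qed simp_all

end
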